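(* We have \[ \sum_{n=0}^{\infty}b_{19}(22n+2)q^{n}\equiv q^{4}\sum_{n=0}^{\infty}b_{19}(2n)q^{11n}\pmod 2 . \] Consequently, for every integer $k\not\equiv 4\pmod{11}$ and every $n\ge0$, \[ b_{19}(242n+22k+2)\equiv 0\pmod 2, \] and, by iteration, for all integers $d\ge1$, $k\ge1$ with $k\not\equiv 4\pmod{11}$ and all $n\ge 0$, \[ b_{19}\!\left(2\cdot 11^{2d}n+2\cdot 11^{2d-1}k+2\cdot 11^{2d-2}+90\cdot\frac{11^{2d-2}-1}{120}\right)\equiv 0\pmod 2 . \]
   Context: For an integer $t\ge 2$, $b_t(n)$ denotes the number of partitions of $n$ none of whose parts is divisible by $t$ (with $b_t(0)=1$); equivalently $\sum_{n\ge0}b_t(n)q^n=f_t/f_1$, where $f_k=\prod_{j\ge1}(1-q^{jk})$. Congruences of power series are coefficientwise. *)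

theory Defs
  imports
    "HOL-Library.Multiset"
    "HOL-Number_Theory.Cong"
    "HOL-Computational_Algebra.Formal_Power_Series"
begin

text \<open>A partition of \<open>n\<close> is encoded as the finite multiset of its parts.\<close>

definition partitions_of :: "nat \<Rightarrow> nat multiset set"
  where "partitions_of n = {p. 0 \<notin># p \<and> sum_mset p = n}"

definition b_reg :: "nat \<Rightarrow> nat \<Rightarrow> nat"
  where "b_reg t n = card {p \<in> partitions_of n. \<forall>m\<in>#p. \<not> t dvd m}"

definition fps_cong :: "int fps \<Rightarrow> int fps \<Rightarrow> int \<Rightarrow> bool"
  where "fps_cong F G m \<longleftrightarrow> (\<forall>i. [fps_nth F i = fps_nth G i] (mod m))"

end

(*
Write M = 12 n + 5. Modulo 2 we have f_1^2 = f_2, so the generating function of b_19(2 n) is the even part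
of f_1 f_19 divided by f_1. The point is the identity, modulo 2,

  even part of f_1 f_19 (with q^2 replaced by q)
    = f_1 * (psi(q^3) + q^6 f_1 W(q^19) + q^2 psi(q^19)),

where psi(q) = sum q^(u(u+1)/2) and W(q) = sum over w > 0 prime to 3 of q^((w^2-1)/3). Comparing
coefficients, and using f_1^2 = f_2 once more, it says that the numbers of positive solutions of
  x^2 + 19 y^2 = 4 M,   x^2 + 9 y^2 = 2 M,   x^2 + 57 y^2 = 2 M
have even sum. By reduction of binary quadratic forms the primitive solutions of x^2 + d y^2 = c M up to
sign correspond to the square roots of -d modulo M up to sign, so one has to show that the numbers of
square roots of -19, -9 and -57 modulo M have a sum divisible by 4. This follows from the Chinese
remainder theorem, splitting off a prime p = 2 (mod 3) of odd multiplicity in M, for which -3 is not a square.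

The coefficient of q^n in the bracket is, modulo 2, the number of representations of 24 n + 9 as 9 u^2, as
x^2 + 152 y^2 with 3 not dividing x, or as 57 y^2. Since -152 is not a square modulo 11, the values of these
forms are divisible by 11 only if 11 divides the variables, which gives the self-similarity under
n -> 121 n + 45.
*)
theory Submission
  imports
    Defs
    "HOL-Number_Theory.Number_Theory"
    "HOL-Library.Z2"
    "HOL-Computational_Algebra.Formal_Laurent_Series"
begin

section \<open>Square roots modulo an integer\<close>

text \<open>The modulus 4 is a count of signs: a positive solution stands for four signed ones, and
  a square root carries two primitive representations, so evenness of the sum of positive counts
  amounts to divisibility by 8 for signed solutions and by 4 for roots. Write M = p^k m with m prime
  to p. Each root count is a local factor 0 or 2 times a count modulo m, which is even unless m
  divides 9, 19 or 57. As m is prime to 3, only m = 1 and m = 19 are exceptional. There -57 =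
  (-3)(-1)(-19) and the nonresidue -3 tie the three Legendre symbols together, and M = 1 (mod 4)
  decides the symbol of -1, so that an even number of local factors survives. The correspondence
  between roots and representations is obstructed by the discriminants -36 and -228, which have
  several classes. Each genus contains only one primitive class, so M = 5 (mod 12) leaves a single
  candidate, all others being excluded modulo 3 or modulo 8. That a form takes the value 1 is the
  test for the principal class.\<close>

definition neg_sqrts :: "int \<Rightarrow> int \<Rightarrow> int set"
  where "neg_sqrts d n = {r \<in> {0..<n}. n dvd r\<^sup>2 + d}"

lemma finite_neg_sqrts [simp]: "finite (neg_sqrts d n)"
  unfolding neg_sqrts_def by (rule finite_subset[of _ "{0..<n}"]) auto

lemma dvd_square_plus_mod_iff:
  fixes n r d :: int
  shows "n dvd (r mod n)\<^sup>2 + d \<longleftrightarrow> n dvd r\<^sup>2 + d"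
proof -
  have "[(r mod n)\<^sup>2 + d = r\<^sup>2 + d] (mod n)"
    by (intro cong_add cong_pow) (simp_all add: cong_def)
  then show ?thesis by (simp add: cong_dvd_iff)
qed

lemma card_neg_sqrts_mult:
  assumes "coprime m n" "0 < m" "0 < n"
  shows "card (neg_sqrts d (m * n)) = card (neg_sqrts d m) * card (neg_sqrts d n)"
proof -
  have "bij_betw (\<lambda>r. (r mod m, r mod n)) (neg_sqrts d (m * n)) (neg_sqrts d m \<times> neg_sqrts d n)"
  proof (rule bij_betw_imageI)
    show "inj_on (\<lambda>r. (r mod m, r mod n)) (neg_sqrts d (m * n))"
    proof (rule inj_onI)
      fix r s assume r: "r \<in> neg_sqrts d (m * n)" and s: "s \<in> neg_sqrts d (m * n)"
        and eq: "(r mod m, r mod n) = (s mod m, s mod n)"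
      have "[r = s] (mod m)" "[r = s] (mod n)" using eq by (auto simp: cong_def)
      then have "[r = s] (mod (m * n))" using assms(1) by (simp add: coprime_cong_mult)
      then show "r = s" using r s by (auto simp: neg_sqrts_def cong_def)
    qed
    show "(\<lambda>r. (r mod m, r mod n)) ` neg_sqrts d (m * n) = neg_sqrts d m \<times> neg_sqrts d n"
    proof (intro equalityI subsetI)
      fix z assume "z \<in> (\<lambda>r. (r mod m, r mod n)) ` neg_sqrts d (m * n)"
      then obtain r where r: "r \<in> neg_sqrts d (m * n)" "z = (r mod m, r mod n)" by auto
      have "m * n dvd r\<^sup>2 + d" using r by (simp add: neg_sqrts_def)
      then have "m dvd r\<^sup>2 + d" "n dvd r\<^sup>2 + d" by (auto dest: dvd_mult_left dvd_mult_right)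
      then show "z \<in> neg_sqrts d m \<times> neg_sqrts d n"
        using r assms by (auto simp: neg_sqrts_def dvd_square_plus_mod_iff)
    next
      fix z assume "z \<in> neg_sqrts d m \<times> neg_sqrts d n"
      then obtain a b where z: "z = (a, b)" and a: "a \<in> neg_sqrts d m" and b: "b \<in> neg_sqrts d n"
        by auto
      obtain x where x: "[x = a] (mod m)" "[x = b] (mod n)"
        using binary_chinese_remainder_int[OF assms(1)] by blast
      define r where "r = x mod (m * n)"
      have rm: "r mod m = a" and rn: "r mod n = b"
        using x a b unfolding r_def
        by (auto simp: neg_sqrts_def cong_def mod_mod_cancel)
      have "m dvd r\<^sup>2 + d" "n dvd r\<^sup>2 + d"
        using a b rm rn dvd_square_plus_mod_iff[of m r d] dvd_square_plus_mod_iff[of n r d]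
        by (auto simp: neg_sqrts_def)
      then have "m * n dvd r\<^sup>2 + d" using assms(1) by (simp add: divides_mult)
      moreover have "r \<in> {0..<m * n}" using assms unfolding r_def by simp
      ultimately have "r \<in> neg_sqrts d (m * n)" by (simp add: neg_sqrts_def)
      then show "z \<in> (\<lambda>r. (r mod m, r mod n)) ` neg_sqrts d (m * n)"
        using rm rn z by force
    qed
  qed
  then show ?thesis by (simp add: bij_betw_same_card card_cartesian_product)
qed

text \<open>The involution r -> m - r stays inside \<open>{0..<m}\<close> because the root 0 is
  ruled out by \<open>m\<close> not dividing \<open>d\<close>, and it has no fixed point because
  \<open>m\<close> is odd.\<close>

lemma even_card_neg_sqrts:
  assumes "odd m" "0 < m" "\<not> m dvd d"
  shows "even (card (neg_sqrts d m))"
proof -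
  define f where "f = (\<lambda>r::int. m - r)"
  have pos: "0 < r" if "r \<in> neg_sqrts d m" for r
    using that assms(3) by (cases "r = 0") (auto simp: neg_sqrts_def)
  have fR: "f r \<in> neg_sqrts d m" if "r \<in> neg_sqrts d m" for r
  proof -
    have "f r ^ 2 + d = (r\<^sup>2 + d) + m * (m - 2 * r)"
      by (simp add: f_def power2_eq_square algebra_simps)
    moreover have "m dvd (r\<^sup>2 + d) + m * (m - 2 * r)"
      using that dvd_add[OF _ dvd_triv_left] by (auto simp: neg_sqrts_def simp del: dvd_add_times_triv_right_iff)
    ultimately have "m dvd f r ^ 2 + d" by (simp only:)
    then show ?thesis using that pos[OF that] by (simp add: neg_sqrts_def f_def)
  qed
  define A where "A = {r \<in> neg_sqrts d m. 2 * r < m}"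
  define B where "B = {r \<in> neg_sqrts d m. 2 * r > m}"
  have AB: "neg_sqrts d m = A \<union> B" "A \<inter> B = {}"
    using assms(1) unfolding A_def B_def by (auto simp: not_less le_less)
  have "bij_betw f A B"
    by (rule bij_betw_byWitness[where f' = f]) (use fR in \<open>auto simp: A_def B_def f_def\<close>)
  then have "card A = card B" by (rule bij_betw_same_card)
  moreover have "card (neg_sqrts d m) = card A + card B"
    using AB by (metis card_Un_disjoint finite_Un finite_neg_sqrts)
  ultimately show ?thesis by simp
qed

text \<open>Hensel lifting: replacing s by s + p^k t changes s^2 + a by 2 s t p^k modulo p^(k+1),
  and 2 s is invertible modulo p since p divides neither 2 nor \<open>a\<close>.\<close>

lemma square_lift_prime_power:
  fixes p :: int
  assumes "prime p" "odd p" "\<not> p dvd a" "p dvd r\<^sup>2 + a" "0 < k"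
  shows "\<exists>s. p ^ k dvd s\<^sup>2 + a"
  using assms(5)
proof (induction k rule: nat_induct_non_zero)
  case 1 then show ?case using assms(4) by auto
next
  case (Suc k)
  then obtain s where s: "p ^ k dvd s\<^sup>2 + a" by auto
  then obtain c where c: "s\<^sup>2 + a = p ^ k * c" by auto
  have "p dvd s\<^sup>2 + a" using s Suc.hyps by (meson dvd_power dvd_trans)
  then have "\<not> p dvd s" using assms(3) by (metis dvd_add_right_iff dvd_mult power2_eq_square)
  have "\<not> p dvd 2"
    using assms(1,2) by (metis primes_dvd_imp_eq two_is_prime_nat prime_int_numeral_eq even_numeral
        dvd_refl)
  then have "\<not> p dvd 2 * s"
    using assms(1) \<open>\<not> p dvd s\<close> prime_dvd_multD by blast
  then have "coprime (2 * s) p"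
    using assms(1) by (metis prime_imp_coprime coprime_commute)
  then obtain u where "[2 * s * u = 1] (mod p)" using cong_solve_coprime_int by blast
  then have "[(2 * s * u) * (- c) = 1 * (- c)] (mod p)" by (rule cong_scalar_right)
  then obtain t where t: "[2 * s * t = - c] (mod p)" using that[of "u * - c"] by (simp add: mult.assoc)
  then have "p dvd 2 * s * t + c" by (simp add: cong_iff_dvd_diff)
  then obtain e where e: "2 * s * t + c = p * e" by auto
  obtain j where j: "k = Suc j" using Suc.hyps by (cases k) auto
  have "(s + p ^ k * t)\<^sup>2 + a = (s\<^sup>2 + a) + p ^ k * (2 * s * t) + p ^ k * p ^ k * t\<^sup>2"
    by (simp add: power2_eq_square algebra_simps)
  also have "\<dots> = p ^ k * (2 * s * t + c) + p ^ k * p ^ k * t\<^sup>2"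
    using c by (simp add: algebra_simps)
  also have "\<dots> = p ^ Suc k * (e + p ^ j * t\<^sup>2)"
    unfolding e by (simp add: j algebra_simps)
  finally show ?case by (metis dvd_triv_left)
qed

text \<open>For two roots x and s, p^k divides (x - s)(x + s), and p cannot divide both factors
  since it does not divide 2 s. One factor absorbs the whole power, so x is s or -s modulo
  p^k.\<close>

lemma card_neg_sqrts_prime_power:
  assumes p: "prime p" "odd p" "\<not> p dvd d" and k: "0 < k"
  shows "card (neg_sqrts d (p ^ k)) = (if \<exists>r. p dvd r\<^sup>2 + d then 2 else 0)"
proof (cases "\<exists>r. p dvd r\<^sup>2 + d")
  case False
  have "neg_sqrts d (p ^ k) = {}"
  proof (rule ccontr)
    assume "neg_sqrts d (p ^ k) \<noteq> {}"
    then obtain r where "p ^ k dvd r\<^sup>2 + d" by (auto simp: neg_sqrts_def)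
    then show False using False k by (meson dvd_power dvd_trans)
  qed
  then show ?thesis using False by simp
next
  case True
  then obtain r where "p dvd r\<^sup>2 + d" by auto
  then obtain s0 where s0: "p ^ k dvd s0\<^sup>2 + d" using square_lift_prime_power[OF p] k by blast
  define q where "q = p ^ k"
  have q: "odd q" "0 < q" "p dvd q" using p k prime_gt_0_int[OF p(1)] unfolding q_def by auto
  define s where "s = s0 mod q"
  have s: "q dvd s\<^sup>2 + d" "0 \<le> s" "s < q"
    using s0 q by (auto simp: s_def q_def dvd_square_plus_mod_iff)
  have ps: "\<not> p dvd s"
    using p(3) s(1) q(3) by (metis dvd_add_right_iff dvd_mult dvd_trans power2_eq_square)
  have sne: "s \<noteq> q - s" using q(1) by (metis diff_add_cancel dvd_triv_left mult_2)
  have "neg_sqrts d q = {s, q - s}"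
  proof (intro equalityI subsetI)
    fix x assume x: "x \<in> neg_sqrts d q"
    have "q dvd (x\<^sup>2 + d) - (s\<^sup>2 + d)"
      using x s(1) by (intro dvd_diff) (simp_all add: neg_sqrts_def)
    then have dv: "q dvd (x - s) * (x + s)" by (simp add: power2_eq_square algebra_simps)
    have "\<not> (p dvd x - s \<and> p dvd x + s)"
    proof
      assume "p dvd x - s \<and> p dvd x + s"
      then have "p dvd (x + s) - (x - s)" using dvd_diff by blast
      then have "p dvd 2 * s" by simp
      then have "p dvd 2" using ps p(1) prime_dvd_multD by blast
      then show False
        using p(1,2) by (metis primes_dvd_imp_eq two_is_prime_nat prime_int_numeral_eq dvd_refl)
    qed
    then have "coprime (p ^ k) (x - s) \<or> coprime (p ^ k) (x + s)"
      using p(1) by (meson coprime_power_left_iff prime_imp_coprime)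
    then have "q dvd x - s \<or> q dvd x + s"
      using dv unfolding q_def by (metis coprime_dvd_mult_right_iff coprime_dvd_mult_left_iff)
    then show "x \<in> {s, q - s}"
    proof
      assume "q dvd x - s"
      then have "x mod q = s mod q" by (simp add: mod_eq_dvd_iff)
      then show ?thesis using x s by (simp add: neg_sqrts_def)
    next
      assume "q dvd x + s"
      then obtain c where c: "x + s = q * c" by (elim dvdE)
      have "s \<noteq> 0" using ps by auto
      then have "0 < x + s" "x + s < 2 * q" using x s by (auto simp: neg_sqrts_def)
      have "0 < q * c" "q * c < q * 2"
        using c \<open>0 < x + s\<close> \<open>x + s < 2 * q\<close> by (simp_all only: mult.commute)
      then have "0 < c" "c < 2"
        using q(2) by (simp_all add: zero_less_mult_iff mult_less_cancel_left_pos)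
      then have "c = 1" by simp
      then show ?thesis using c by simp
    qed
  next
    fix x assume "x \<in> {s, q - s}"
    moreover have "q dvd (q - s)\<^sup>2 + d"
    proof -
      have "(q - s)\<^sup>2 + d = (s\<^sup>2 + d) + q * (q - 2 * s)" by (simp add: power2_eq_square algebra_simps)
      moreover have "q dvd (s\<^sup>2 + d) + q * (q - 2 * s)" using s(1) by (metis dvd_add dvd_triv_left)
      ultimately show ?thesis by (simp only:)
    qed
    moreover have "s \<noteq> 0" using ps by auto
    ultimately show "x \<in> neg_sqrts d q" using s by (auto simp: neg_sqrts_def)
  qed
  then have "card (neg_sqrts d q) = 2" using sne by simp
  then show ?thesis using True by (auto simp: q_def)
qed

section \<open>Legendre symbols of -1, -3 and the local root counts\<close>

lemma Legendre_eq_1_iff_dvd: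
  fixes p a :: int
  assumes "prime p" "\<not> p dvd a"
  shows "Legendre (- a) p = 1 \<longleftrightarrow> (\<exists>r. p dvd r\<^sup>2 + a)"
  using assms by (auto simp: Legendre_def QuadRes_def cong_0_iff cong_iff_dvd_diff)

text \<open>Euler's criterion only yields congruences modulo p; this turns them into equalities of
  symbols.\<close>

lemma cong_sign_imp_eq:
  fixes p x y :: int
  assumes "[x = y] (mod p)" "2 < p" "x \<in> {-1, 0, 1}" "y \<in> {-1, 0, 1}"
  shows "x = y"
proof (rule ccontr)
  assume "x \<noteq> y"
  moreover have "p dvd x - y" using assms(1) by (simp add: cong_iff_dvd_diff)
  ultimately have "\<bar>p\<bar> \<le> \<bar>x - y\<bar>" by (intro dvd_imp_le_int) auto
  moreover have "\<bar>x - y\<bar> \<le> 2" using assms(3,4) by auto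
  ultimately show False using assms(2) by simp
qed

lemma euler_criterion_int:
  fixes p a :: int
  assumes "prime p" "2 < p"
  shows "[Legendre a p = a ^ ((nat p - 1) div 2)] (mod p)"
proof -
  have "prime (nat p)" using assms(1) by (metis prime_int_nat_transfer)
  moreover have "2 < nat p" "int (nat p) = p" using assms(2) by linarith+
  ultimately show ?thesis using euler_criterion[of "nat p" a] by metis
qed

lemma Legendre_mult:
  fixes p a b :: int
  assumes "prime p" "2 < p"
  shows "Legendre (a * b) p = Legendre a p * Legendre b p"
proof (rule cong_sign_imp_eq[OF _ assms(2)])
  have "[Legendre a p * Legendre b p = (a * b) ^ ((nat p - 1) div 2)] (mod p)"
    unfolding power_mult_distrib by (intro cong_mult euler_criterion_int assms)
  then show "[Legendre (a * b) p = Legendre a p * Legendre b p] (mod p)"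
    using euler_criterion_int[OF assms] by (metis cong_sym cong_trans)
qed (auto simp: Legendre_def)

lemma Legendre_square:
  fixes p a :: int
  assumes "prime p" "\<not> p dvd a"
  shows "Legendre (a\<^sup>2) p = 1"
proof -
  have "QuadRes p (a\<^sup>2)" unfolding QuadRes_def by (blast intro: cong_refl)
  moreover have "\<not> p dvd a\<^sup>2" using assms prime_dvd_power by blast
  ultimately show ?thesis by (simp add: Legendre_def cong_0_iff)
qed

lemma Legendre_minus_one:
  fixes p :: int
  assumes "prime p" "2 < p"
  shows "Legendre (-1) p = (-1) ^ ((nat p - 1) div 2)"
proof (rule cong_sign_imp_eq[OF euler_criterion_int[OF assms] assms(2)])
  show "(-1::int) ^ ((nat p - 1) div 2) \<in> {-1, 0, 1}"
    by (cases "even ((nat p - 1) div 2)") auto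
qed (simp add: Legendre_def)

lemma Legendre_minus_one_cases:
  fixes p :: int
  assumes "prime p" "2 < p"
  shows "Legendre (-1) p = (if p mod 4 = 1 then 1 else -1)"
proof -
  have "odd p" using assms by (simp add: prime_odd_int)
  then obtain j where j: "p = 2 * j + 1" by (elim oddE)
  then have "(nat p - 1) div 2 = nat j" "0 < j" using assms(2) by auto
  moreover have "even (nat j) \<longleftrightarrow> even j" using \<open>0 < j\<close> by (simp add: even_nat_iff)
  moreover have "even j \<longleftrightarrow> p mod 4 = 1" unfolding j by presburger
  ultimately have "even ((nat p - 1) div 2) \<longleftrightarrow> p mod 4 = 1" by simp
  then show ?thesis using Legendre_minus_one[OF assms] by simp
qed

text \<open>As p = 2 (mod 3) is not a square modulo 3, reciprocity gives (3/p) = -(-1/p);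
  multiplying by (-1/p) removes the dependence on p modulo 4.\<close>

lemma Legendre_minus_three:
  fixes p :: int
  assumes "prime p" "2 < p" "p mod 3 = 2"
  shows "Legendre (-3) p = -1"
proof -
  have "\<not> QuadRes 3 p"
  proof
    assume "QuadRes 3 p"
    then obtain y where "y\<^sup>2 mod 3 = p mod 3" by (auto simp: QuadRes_def cong_def)
    then have "(y mod 3)\<^sup>2 mod 3 = 2" using assms(3) by (simp add: power_mod)
    moreover have "y mod 3 \<in> {0, 1, 2}" by auto
    ultimately show False by auto
  qed
  then have "Legendre p 3 = -1" using assms(3) by (simp add: Legendre_def cong_def)
  moreover have "Legendre p 3 * Legendre 3 p = (-1) ^ ((nat p - 1) div 2)"
  proof -
    have "prime (nat p)" using assms(1) by (metis prime_int_nat_transfer)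
    moreover have "2 < nat p" "int (nat p) = p" using assms(2) by linarith+
    moreover have "p \<noteq> 3" using assms(3) by auto
    then have "nat p \<noteq> 3" using assms(2) by linarith
    moreover have "prime (3::nat)" by simp
    ultimately have "Legendre (int (nat p)) (int 3) * Legendre (int 3) (int (nat p))
        = (-1) ^ ((nat p - 1) div 2 * ((3 - 1) div 2))"
      by (intro Quadratic_Reciprocity) linarith+
    then show ?thesis unfolding \<open>int (nat p) = p\<close> by simp
  qed
  ultimately have "Legendre 3 p = - Legendre (-1) p"
    using Legendre_minus_one[OF assms(1,2)] by simp
  moreover have "Legendre (-3) p = Legendre (-1) p * Legendre 3 p"
    using Legendre_mult[OF assms(1,2), of "-1" 3] by simp
  moreover have "Legendre (-1) p * Legendre (-1) p = 1"
    by (simp add: Legendre_minus_one_cases[OF assms(1,2)])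
  ultimately show ?thesis by simp
qed

lemma card_neg_sqrts_prime_power_Legendre:
  fixes p d :: int
  assumes "prime p" "2 < p" "\<not> p dvd d" "0 < k"
  shows "card (neg_sqrts d (p ^ k)) = (if Legendre (- d) p = 1 then 2 else 0)"
proof -
  have "odd p" using assms(1,2) by (rule prime_odd_int)
  then show ?thesis
    unfolding card_neg_sqrts_prime_power[OF assms(1) _ assms(3,4)]
      Legendre_eq_1_iff_dvd[OF assms(1,3)] by (rule card_neg_sqrts_prime_power[OF assms(1) _ assms(3,4)])
qed

text \<open>Otherwise every prime power in the factorization of M would be 1 (mod 3), and hence M
  itself.\<close>

lemma prime_factor_odd_multiplicity:
  fixes M :: int
  assumes "0 < M" "M mod 3 = 2"
  shows "\<exists>p. prime p \<and> p mod 3 = 2 \<and> odd (multiplicity p M)"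
proof (rule ccontr)
  assume *: "\<not> ?thesis"
  have "[p ^ multiplicity p M = 1] (mod 3)" if p: "p \<in> prime_factors M" for p
  proof -
    have "prime p" using p by auto
    have "\<not> 3 dvd p"
      using p assms by (metis dvd_trans dvd_eq_mod_eq_0 in_prime_factors_iff zero_neq_numeral)
    then have "p mod 3 = 1 \<or> p mod 3 = 2" by presburger
    then show ?thesis
    proof
      assume "p mod 3 = 1"
      then have "[p ^ multiplicity p M = 1 ^ multiplicity p M] (mod 3)"
        by (intro cong_pow) (simp add: cong_def)
      then show ?thesis by simp
    next
      assume p2: "p mod 3 = 2"
      then have "even (multiplicity p M)" using * \<open>prime p\<close> by blast
      moreover have "[p ^ multiplicity p M = (-1) ^ multiplicity p M] (mod 3)"
        using p2 by (intro cong_pow) (simp add: cong_def)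
      ultimately show ?thesis by simp
    qed
  qed
  then have "[(\<Prod>p\<in>prime_factors M. p ^ multiplicity p M) = (\<Prod>p\<in>prime_factors M. 1)] (mod 3)"
    by (rule cong_prod)
  then have "[M = 1] (mod 3)"
    using assms(1) prime_factorization_int[of M] by simp
  then show False using assms(2) by (simp add: cong_def)
qed

lemma four_dvd_sum_card_neg_sqrts:
  fixes M :: int
  assumes "0 < M" "M mod 12 = 5"
  shows "4 dvd card (neg_sqrts 19 M) + card (neg_sqrts 9 M) + card (neg_sqrts 57 M)"
proof -
  have M: "odd M" "M mod 3 = 2" "M mod 4 = 1" using assms(2) by presburger+
  obtain p where p: "prime p" "p mod 3 = 2" "odd (multiplicity p M)"
    using prime_factor_odd_multiplicity[OF assms(1) M(2)] by blast
  define k where "k = multiplicity p M"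
  have k: "odd k" "0 < k" using p(3) odd_pos by (auto simp: k_def)
  obtain m where m: "M = p ^ k * m" "\<not> p dvd m"
    using multiplicity_decompose'[of M p] assms(1) p(1) unfolding k_def
    by (metis less_irrefl not_prime_unit)
  have pM: "p dvd M" using m(1) k(2) by simp
  then have "p \<noteq> 2" using M(1) by auto
  then have p2: "2 < p" using prime_ge_2_int[OF p(1)] by simp
  then have "odd p" using p(1) by (simp add: prime_odd_int)
  have p3: "\<not> p dvd 3" using p(1,2) primes_dvd_imp_eq[of p 3] by auto
  have "prime (19::int)" by simp
  then have p19: "\<not> p dvd 19" using p(1,2) primes_dvd_imp_eq[of p 19] by auto
  have p9: "\<not> p dvd 9" using p(1) p3 prime_dvd_multD[of p 3 3] by auto
  have p57: "\<not> p dvd 57" using p(1) p3 p19 prime_dvd_multD[of p 3 19] by auto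
  have mpos: "0 < m" using m(1) assms(1) p2 by (simp add: zero_less_mult_iff)
  have modd: "odd m" using M(1) m(1) by simp
  have cop: "coprime (p ^ k) m" using m(2) p(1) by (simp add: prime_imp_coprime)
  \<comment> \<open>The local factor: the number of square roots of -d modulo p^k when p does not
    divide d.\<close>
  define l where "l d = (if Legendre (- d) p = 1 then 2 else 0::nat)" for d
  have split: "card (neg_sqrts d M) = l d * card (neg_sqrts d m)" if "\<not> p dvd d" for d
    using card_neg_sqrts_mult[OF cop] card_neg_sqrts_prime_power_Legendre[OF p(1) p2 that k(2)]
      mpos p2 m(1) by (simp add: l_def)
  have L3: "Legendre (-3) p = -1" using Legendre_minus_three[OF p(1) p2 p(2)] .
  have L1: "Legendre (-1) p = (if p mod 4 = 1 then 1 else -1)"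
    using Legendre_minus_one_cases[OF p(1) p2] .
  have L9: "Legendre (-9) p = Legendre (-1) p"
    using Legendre_mult[OF p(1) p2, of "-1" "3\<^sup>2"] Legendre_square[OF p(1) p3] by simp
  \<comment> \<open>The minus sign is the symbol of -3. Consequently the symbols of -19, -9 and -57
    multiply to -1.\<close>
  have L57: "Legendre (-57) p = - (Legendre (-1) p * Legendre (-19) p)"
  proof -
    have "Legendre (-57) p = Legendre (-3) p * Legendre ((-1) * (-19)) p"
      using Legendre_mult[OF p(1) p2, of "-3" 19] by simp
    then show ?thesis using L3 Legendre_mult[OF p(1) p2, of "-1" "-19"] by simp
  qed
  have L19: "Legendre (-19) p \<in> {1, -1}" using p19 by (auto simp: Legendre_def cong_0_iff)
  \<comment> \<open>Here k has to be odd. Once m is known, \<open>M mod 4 = 1\<close> then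
    determines p modulo 4.\<close>
  have pk4: "[p ^ k = p] (mod 4)"
  proof -
    have "[p ^ 2 = 1] (mod 4)"
      using \<open>odd p\<close> by (elim oddE) (simp add: cong_iff_dvd_diff power2_eq_square algebra_simps)
    moreover obtain j where j: "k = 2 * j + 1" using k(1) by (elim oddE)
    ultimately have "[(p ^ 2) ^ j * p = 1 ^ j * p] (mod 4)" by (intro cong_scalar_right cong_pow)
    then show ?thesis by (simp only: j power_add power_mult power_one_right power_one mult_1)
  qed
  consider "m = 1" | "m = 19" | "\<not> m dvd 9" "\<not> m dvd 19" "\<not> m dvd 57"
  proof -
    have "\<not> 3 dvd m" using m(1) M(2) by (metis dvd_eq_mod_eq_0 dvd_mult zero_neq_numeral)
    have coprime3: "coprime m 3" if "\<not> 3 dvd m"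
    proof -
      have "prime (3::int)" by simp
      then show ?thesis using that prime_imp_coprime coprime_commute by blast
    qed
    have "m = 1" if "m dvd 9"
    proof -
      have "coprime m 3" using \<open>\<not> 3 dvd m\<close> by (rule coprime3)
      then have "coprime m (3 * 3)" by (simp only: coprime_mult_right_iff)
      moreover have "m dvd 3 * 3" using that by simp
      ultimately have "is_unit m" by (metis coprime_common_divisor dvd_refl)
      then show ?thesis using mpos by simp
    qed
    moreover have "m = 1 \<or> m = 19" if "m dvd 19"
      using that mpos \<open>prime 19\<close> by (metis prime_int_iff less_imp_le)
    moreover have "m dvd 19" if "m dvd 57"
    proof -
      have "coprime m 3" using \<open>\<not> 3 dvd m\<close> by (rule coprime3)
      moreover have "m dvd 3 * 19" using that by simp
      ultimately show ?thesis using coprime_dvd_mult_right_iff by blast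
    qed
    ultimately show thesis using that by blast
  qed
  then show ?thesis
  proof cases
    case 1
    \<comment> \<open>Now (-1/p) = 1: the factor for 9 is 2, and exactly one of those for 19 and 57
      is 2, so the total is 4.\<close>
    then have "p mod 4 = 1" using pk4 M(3) m(1) by (simp add: cong_def)
    moreover have "card (neg_sqrts d 1) = 1" for d
    proof -
      have "neg_sqrts d 1 = {0}" by (auto simp: neg_sqrts_def)
      then show ?thesis by simp
    qed
    ultimately show ?thesis
      using L1 L9 L57 L19 1 by (auto simp: split p9 p19 p57 l_def) presburger+
  next
    case 2
    \<comment> \<open>As 19 = 3 (mod 4), also p = 3 (mod 4) and (-1/p) = -1: the factor for 9
      vanishes, those for 19 and 57 agree, and each multiplies a count of 1, the only root modulo 19
      being 0.\<close>
    have "(p mod 4) * 3 mod 4 = 1"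
      using pk4 M(3) m(1) 2 mod_mult_eq[of "p ^ k" 4 19] by (simp add: cong_def mod_mult_left_eq)
    then have "p mod 4 \<noteq> 1" by auto
    moreover have "neg_sqrts 19 19 = {0}" "neg_sqrts 57 19 = {0}"
    proof -
      have "r = 0" if "19 dvd r\<^sup>2" "0 \<le> r" "r < 19" for r :: int
        using that \<open>prime 19\<close> by (metis prime_dvd_power zdvd_not_zless le_less)
      moreover have "19 dvd r\<^sup>2 + 19 \<longleftrightarrow> 19 dvd r\<^sup>2" "19 dvd r\<^sup>2 + 57 \<longleftrightarrow> 19 dvd r\<^sup>2" for r :: int
        by presburger+
      ultimately show "neg_sqrts 19 19 = {0}" "neg_sqrts 57 19 = {0}"
        by (auto simp: neg_sqrts_def)
    qed
    ultimately show ?thesis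
      using L1 L9 L57 L19 2 by (auto simp: split p9 p19 p57 l_def)
  next
    case 3
    have "4 dvd card (neg_sqrts d M)" if "\<not> p dvd d" "\<not> m dvd d" for d
    proof -
      have "even (l d)" "even (card (neg_sqrts d m))"
        using even_card_neg_sqrts[OF modd mpos that(2)] by (auto simp: l_def)
      then have "2 * 2 dvd l d * card (neg_sqrts d m)" by (rule mult_dvd_mono)
      then show ?thesis using split[OF that(1)] by simp
    qed
    then show ?thesis using 3 p9 p19 p57 by (intro dvd_add) auto
  qed
qed

section \<open>Representations by binary quadratic forms\<close>

text \<open>Equivalence of forms is followed only through the set of values, which shift and swap
  preserve; this spares the substitution matrices.\<close>

definition bqf_values :: "int \<Rightarrow> int \<Rightarrow> int \<Rightarrow> int set"
  where "bqf_values A B C = {A * u\<^sup>2 + B * u * v + C * v\<^sup>2 | u v. True}"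

lemma bqf_values_iff: "m \<in> bqf_values A B C \<longleftrightarrow> (\<exists>u v. A * u\<^sup>2 + B * u * v + C * v\<^sup>2 = m)"
  by (auto simp: bqf_values_def)

lemma bqf_values_swap: "bqf_values C B A = bqf_values A B C"
proof -
  have "bqf_values C B A \<subseteq> bqf_values A B C" for A B C
  proof
    fix m assume "m \<in> bqf_values C B A"
    then obtain u v where "C * u\<^sup>2 + B * u * v + A * v\<^sup>2 = m" by (auto simp: bqf_values_iff)
    then have "A * v\<^sup>2 + B * v * u + C * u\<^sup>2 = m" by (simp add: algebra_simps)
    then show "m \<in> bqf_values A B C" by (auto simp: bqf_values_iff)
  qed
  then show ?thesis by blast
qed

lemma bqf_values_shift:
  "bqf_values A (B + 2 * A * k) (A * k\<^sup>2 + B * k + C) = bqf_values A B C"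
proof -
  have sub: "bqf_values A (B + 2 * A * k) (A * k\<^sup>2 + B * k + C) \<subseteq> bqf_values A B C" for B C k
  proof
    fix m assume "m \<in> bqf_values A (B + 2 * A * k) (A * k\<^sup>2 + B * k + C)"
    then obtain u v where
      "A * u\<^sup>2 + (B + 2 * A * k) * u * v + (A * k\<^sup>2 + B * k + C) * v\<^sup>2 = m"
      by (auto simp: bqf_values_iff)
    then have "A * (u + k * v)\<^sup>2 + B * (u + k * v) * v + C * v\<^sup>2 = m"
      by (simp add: power2_eq_square algebra_simps)
    then show "m \<in> bqf_values A B C" by (auto simp: bqf_values_iff)
  qed
  have "bqf_values A B C \<subseteq> bqf_values A (B + 2 * A * k) (A * k\<^sup>2 + B * k + C)"
    using sub[of "B + 2 * A * k" "- k" "A * k\<^sup>2 + B * k + C"]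
    by (simp add: power2_eq_square algebra_simps)
  with sub show ?thesis by blast
qed

text \<open>Gauss reduction: a shift brings B into [-A, A), and if the new C is below A, a swap
  makes it the leading coefficient, which is the quantity that decreases.\<close>

lemma reduced_bqf_exists:
  fixes A B C :: int
  assumes "0 < A" "B\<^sup>2 - 4 * A * C = - D" "0 < D"
  shows "\<exists>A' B' C'. 0 < A' \<and> \<bar>B'\<bar> \<le> A' \<and> A' \<le> C' \<and> B'\<^sup>2 - 4 * A' * C' = - D
    \<and> bqf_values A' B' C' = bqf_values A B C"
  using assms(1,2)
proof (induction "nat A" arbitrary: A B C rule: less_induct)
  case less
  define k where "k = - ((B + A) div (2 * A))"
  define B' where "B' = B + 2 * A * k"
  define C' where "C' = A * k\<^sup>2 + B * k + C"
  have eq: "bqf_values A B' C' = bqf_values A B C"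
    unfolding B'_def C'_def by (rule bqf_values_shift)
  have disc: "B'\<^sup>2 - 4 * A * C' = - D"
    using less.prems(2) unfolding B'_def C'_def by (simp add: power2_eq_square algebra_simps)
  have "B' + A = (B + A) mod (2 * A)"
    unfolding B'_def k_def by (simp add: minus_mult_div_eq_mod [symmetric])
  then have B': "\<bar>B'\<bar> \<le> A"
    using less.prems(1) pos_mod_sign[of "2 * A" "B + A"] pos_mod_bound[of "2 * A" "B + A"] by linarith
  show ?case
  proof (cases "A \<le> C'")
    case True
    then show ?thesis using less.prems(1) B' disc eq by blast
  next
    case False
    have "0 < C'"
    proof (rule ccontr)
      assume "\<not> 0 < C'"
      then have "A * C' \<le> 0" using less.prems(1) by (simp add: mult_nonneg_nonpos)
      moreover have "0 \<le> B'\<^sup>2" by simp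
      ultimately show False using disc assms(3) by simp
    qed
    moreover have "nat C' < nat A" using False \<open>0 < C'\<close> by simp
    moreover have "B'\<^sup>2 - 4 * C' * A = - D" using disc by (simp add: mult.commute mult.left_commute)
    ultimately obtain A'' B'' C'' where "0 < A''" "\<bar>B''\<bar> \<le> A''" "A'' \<le> C''"
      "B''\<^sup>2 - 4 * A'' * C'' = - D" "bqf_values A'' B'' C'' = bqf_values C' B' A"
      using less.hyps[of C' B' A] by blast
    then show ?thesis using eq bqf_values_swap by metis
  qed
qed

lemma reduced_bqf_bound:
  fixes A B C :: int
  assumes "0 < A" "\<bar>B\<bar> \<le> A" "A \<le> C" "B\<^sup>2 - 4 * A * C = - D"
  shows "3 * A\<^sup>2 \<le> D"
proof -
  have "B\<^sup>2 \<le> A\<^sup>2" using assms(1,2) by (simp add: abs_le_square_iff[symmetric])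
  moreover have "A * A \<le> A * C" using assms(1,3) by (simp add: mult_left_mono)
  ultimately show ?thesis using assms(4) by (simp add: power2_eq_square)
qed

section \<open>Reduced forms of discriminant -19, -36 and -228\<close>

lemma one_mem_bqf_values: "1 \<in> bqf_values 1 B C"
  unfolding bqf_values_iff by (intro exI[of _ 1] exI[of _ 0]) simp

text \<open>Class number one: the leading coefficient of a reduced form is at most 2, and it is not
  2 because -19 is not a square modulo 8.\<close>

lemma bqf_represents_one_19:
  assumes "0 < A" "B\<^sup>2 - 4 * A * C = - 19"
  shows "1 \<in> bqf_values A B C"
proof -
  obtain A' B' C' where r: "0 < A'" "\<bar>B'\<bar> \<le> A'" "A' \<le> C'" "B'\<^sup>2 - 4 * A' * C' = - 19"
    "bqf_values A' B' C' = bqf_values A B C"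
    using reduced_bqf_exists[OF assms] by auto
  have "A'\<^sup>2 < 3\<^sup>2" using reduced_bqf_bound[OF r(1-4)] by simp
  then have "A' < 3" by (rule power2_less_imp_less) simp
  then consider "A' = 1" | "A' = 2" using r(1) by linarith
  then show ?thesis
  proof cases
    case 1 then show ?thesis using r(5) one_mem_bqf_values by metis
  next
    case 2
    then have "B' \<in> {-2, -1, 0, 1, 2}" using r(2) by auto
    then show ?thesis using r(4) 2 by (elim insertE) (simp_all, presburger+)
  qed
qed

lemma square_mod_3_neq_2: "(w::int)\<^sup>2 mod 3 \<noteq> 2"
proof -
  have "w mod 3 \<in> {0, 1, 2}" by auto
  then have "(w mod 3)\<^sup>2 mod 3 \<noteq> 2" by auto
  then show ?thesis by (simp add: power_mod)
qed

lemma square_mod_8: "(w::int)\<^sup>2 mod 8 \<in> {0, 1, 4}"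
proof -
  have "w mod 8 \<in> {0, 1, 2, 3, 4, 5, 6, 7}" by auto
  then have "(w mod 8)\<^sup>2 mod 8 \<in> {0, 1, 4}" by auto
  then show ?thesis by (simp add: power_mod)
qed

text \<open>The reduced forms are (1,0,9), (2,+-2,5) and (3,0,3). The last takes only multiples of
  3; the middle ones take the value 2 M only if M = w^2 + 9 z^2, which is never 2 (mod 3).\<close>

lemma bqf_represents_one_36:
  assumes "0 < A" "B\<^sup>2 - 4 * A * C = - 36" "2 * M \<in> bqf_values A B C" "M mod 12 = 5"
  shows "1 \<in> bqf_values A B C"
proof -
  obtain A' B' C' where r: "0 < A'" "\<bar>B'\<bar> \<le> A'" "A' \<le> C'" "B'\<^sup>2 - 4 * A' * C' = - 36"
    "bqf_values A' B' C' = bqf_values A B C"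
    using reduced_bqf_exists[OF assms(1,2)] by auto
  obtain u v where uv: "A' * u\<^sup>2 + B' * u * v + C' * v\<^sup>2 = 2 * M"
    using assms(3) r(5) bqf_values_iff by metis
  have "A'\<^sup>2 < 4\<^sup>2" using reduced_bqf_bound[OF r(1-4)] by simp
  then have "A' < 4" by (rule power2_less_imp_less) simp
  then consider "A' = 1" | "A' = 2" | "A' = 3" using r(1) by linarith
  then show ?thesis
  proof cases
    case 1 then show ?thesis using r(5) one_mem_bqf_values by metis
  next
    case 2
    then have "B' \<in> {-2, -1, 0, 1, 2}" using r(2) by auto
    then have "(B' = 2 \<or> B' = -2) \<and> C' = 5" using r(4) 2 by (elim insertE) (simp_all, presburger+)
    then obtain s where s: "B' = 2 * s" "s * s = 1" "C' = 5"
      by (metis mult.right_neutral mult_minus_right mult_minus_left minus_minus)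
    have e: "2 * u\<^sup>2 + 2 * (s * u * v) + 5 * v\<^sup>2 = 2 * M" using uv s 2 by (simp add: mult.assoc)
    then have "5 * v\<^sup>2 = 2 * (M - u\<^sup>2 - s * u * v)" by simp
    then have "even (5 * v\<^sup>2)" by (metis dvd_triv_left)
    then have "even v" by simp
    then obtain z where z: "v = 2 * z" by auto
    have "(u + s * z)\<^sup>2 + 9 * z\<^sup>2 = u\<^sup>2 + 2 * (s * u * z) + (s * s) * z\<^sup>2 + 9 * z\<^sup>2"
      by (simp add: power2_eq_square algebra_simps)
    also have "\<dots> = M" using e unfolding s(2) z by (simp add: power2_eq_square)
    finally have "M = (u + s * z)\<^sup>2 + 3 * (3 * z\<^sup>2)" by simp
    then have "(u + s * z)\<^sup>2 mod 3 = M mod 3" by (metis mod_mult_self2)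
    moreover have "M mod 3 = 2" using assms(4) by presburger
    ultimately have "(u + s * z)\<^sup>2 mod 3 = 2" by simp
    then show ?thesis using square_mod_3_neq_2 by blast
  next
    case 3
    then have "B' \<in> {-3, -2, -1, 0, 1, 2, 3}" using r(2) by auto
    then have "B' = 0 \<and> C' = 3" using r(4) 3 by (elim insertE) (simp_all, presburger+)
    then have "3 * u\<^sup>2 + 3 * v\<^sup>2 = 2 * M" using uv 3 by simp
    then show ?thesis using assms(4) by presburger
  qed
qed

text \<open>The reduced forms are (1,0,57), (2,+-2,29), (3,0,19) and (6,+-6,11), one per genus up to
  the sign of the middle coefficient. For the value 2 M, the second and fourth are excluded modulo 3
  and the third modulo 8.\<close>

lemma bqf_represents_one_228:
  assumes "0 < A" "B\<^sup>2 - 4 * A * C = - 228" "2 * M \<in> bqf_values A B C" "M mod 12 = 5"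
  shows "1 \<in> bqf_values A B C"
proof -
  obtain A' B' C' where r: "0 < A'" "\<bar>B'\<bar> \<le> A'" "A' \<le> C'" "B'\<^sup>2 - 4 * A' * C' = - 228"
    "bqf_values A' B' C' = bqf_values A B C"
    using reduced_bqf_exists[OF assms(1,2)] by auto
  obtain u v where uv: "A' * u\<^sup>2 + B' * u * v + C' * v\<^sup>2 = 2 * M"
    using assms(3) r(5) bqf_values_iff by metis
  have "B'\<^sup>2 = 2 * (2 * A' * C' - 114)" using r(4) by simp
  then have "even (B'\<^sup>2)" by (metis dvd_triv_left)
  then obtain b where b: "B' = 2 * b" by auto
  have bc: "b\<^sup>2 + 57 = A' * C'" using r(4) b by (simp add: power2_eq_square)
  have "A'\<^sup>2 < 9\<^sup>2" using reduced_bqf_bound[OF r(1-4)] by simp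
  then have "A' < 9" by (rule power2_less_imp_less) simp
  then have "A' \<in> {1, 2, 3, 4, 5, 6, 7, 8}" "b \<in> {-4, -3, -2, -1, 0, 1, 2, 3, 4}" using r(1,2) b by auto
  then consider "A' = 1" | "A' = 2" "\<bar>b\<bar> = 1" "C' = 29" | "A' = 3" "b = 0" "C' = 19"
    | "A' = 6" "\<bar>b\<bar> = 3" "C' = 11"
    using bc r(2) b by (elim insertE emptyE) (simp_all, presburger+)
  then show ?thesis
  proof cases
    case 1 then show ?thesis using r(5) one_mem_bqf_values by metis
  next
    case 2
    have bb: "b * b = 1" using 2(2) by (simp add: abs_if split: if_splits)
    have e: "2 * u\<^sup>2 + 2 * (b * u * v) + 29 * v\<^sup>2 = 2 * M" using uv b 2 by (simp add: mult.assoc)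
    then have "29 * v\<^sup>2 = 2 * (M - u\<^sup>2 - b * u * v)" by simp
    then have "even (29 * v\<^sup>2)" by (metis dvd_triv_left)
    then have "even v" by simp
    then obtain z where z: "v = 2 * z" by auto
    have "(u + b * z)\<^sup>2 + 57 * z\<^sup>2 = u\<^sup>2 + 2 * (b * u * z) + (b * b) * z\<^sup>2 + 57 * z\<^sup>2"
      by (simp add: power2_eq_square algebra_simps)
    also have "\<dots> = M" using e unfolding bb z by (simp add: power2_eq_square)
    finally have "M = (u + b * z)\<^sup>2 + 3 * (19 * z\<^sup>2)" by simp
    then have "(u + b * z)\<^sup>2 mod 3 = M mod 3" by (metis mod_mult_self2)
    moreover have "M mod 3 = 2" using assms(4) by presburger
    ultimately have "(u + b * z)\<^sup>2 mod 3 = 2" by simp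
    then show ?thesis using square_mod_3_neq_2 by blast
  next
    case 3
    then have "3 * u\<^sup>2 + 19 * v\<^sup>2 = 2 * M" using uv b by simp
    then have "(3 * (u\<^sup>2 mod 8) + 19 * (v\<^sup>2 mod 8)) mod 8 = 2 * M mod 8"
      by (metis mod_add_eq mod_mult_right_eq)
    moreover have "2 * M mod 8 = 2" using assms(4) by presburger
    ultimately show ?thesis using square_mod_8[of u] square_mod_8[of v] by auto
  next
    case 4
    have e: "6 * u\<^sup>2 + 2 * (b * u * v) + 11 * v\<^sup>2 = 2 * M" using uv b 4 by (simp add: mult.assoc)
    then have "11 * v\<^sup>2 = 2 * (M - 3 * u\<^sup>2 - b * u * v)" by simp
    then have "even (11 * v\<^sup>2)" by (metis dvd_triv_left)
    then have "even v" by simp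
    then obtain z where z: "v = 2 * z" by auto
    obtain s where s: "b = 3 * s" using 4(2)
      by (metis abs_eq_iff mult.right_neutral mult_minus_right abs_numeral)
    have "M = z\<^sup>2 + 3 * (u\<^sup>2 + 2 * (s * u * z) + 7 * z\<^sup>2)"
      using e unfolding s z by (simp add: power2_eq_square)
    then have "z\<^sup>2 mod 3 = M mod 3" by (metis mod_mult_self2)
    moreover have "M mod 3 = 2" using assms(4) by presburger
    ultimately have "z\<^sup>2 mod 3 = 2" by simp
    then show ?thesis using square_mod_3_neq_2 by blast
  qed
qed

section \<open>Primitive representations and square roots modulo M\<close>

text \<open>Throughout, the form is \<open>a X\<^sup>2 + a X Y + c Y\<^sup>2\<close> with \<open>a (d + 1) = 4 c\<close>, i.e. four times it is
  \<open>a ((2 X + Y)\<^sup>2 + d Y\<^sup>2)\<close>; the triples \<open>(a, c, d)\<close> are \<open>(1, 5, 19)\<close>, \<open>(2, 5, 9)\<close> and \<open>(2, 29, 57)\<close>.\<close>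

definition proper_reps :: "int \<Rightarrow> int \<Rightarrow> int \<Rightarrow> (int \<times> int) set"
  where "proper_reps a c M = {(X, Y). a * X\<^sup>2 + a * X * Y + c * Y\<^sup>2 = M \<and> coprime X Y}"

lemma bqf_norm_identity:
  fixes a c d X Y :: int
  assumes "a * (d + 1) = 4 * c"
  shows "4 * (a * X\<^sup>2 + a * X * Y + c * Y\<^sup>2) = a * ((2 * X + Y)\<^sup>2 + d * Y\<^sup>2)"
proof -
  have "4 * (a * X\<^sup>2 + a * X * Y + c * Y\<^sup>2) = 4 * a * X\<^sup>2 + 4 * a * X * Y + (4 * c) * Y\<^sup>2"
    by (simp add: algebra_simps)
  also have "\<dots> = a * ((2 * X + Y)\<^sup>2 + d * Y\<^sup>2)"
    unfolding assms[symmetric] by (simp add: power2_eq_square algebra_simps)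
  finally show ?thesis .
qed

text \<open>A primitive vector generates the integer points on its line, so vanishing of the
  determinant leaves only a sign.\<close>

lemma coprime_cross_eq:
  fixes X Y X' Y' :: int
  assumes "coprime X Y" "coprime X' Y'" "X * Y' = X' * Y"
  shows "(X', Y') = (X, Y) \<or> (X', Y') = (- X, - Y)"
proof -
  have "X dvd X' * Y" "X' dvd X * Y'" using assms(3) by (metis dvd_triv_left)+
  then have "X dvd X'" "X' dvd X"
    using assms(1,2) by (simp_all add: coprime_dvd_mult_left_iff)
  then have "\<bar>X\<bar> = \<bar>X'\<bar>" using zdvd_antisym_abs by blast
  then have X: "X' = X \<or> X' = - X" by linarith
  show ?thesis
  proof (cases "X = 0")
    case True
    then show ?thesis using X assms(1,2) by auto
  next
    case False
    from X show ?thesis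
    proof
      assume "X' = - X"
      then have "X * Y' = X * (- Y)" using assms(3) by simp
      then show ?thesis using False \<open>X' = - X\<close> by (simp only: mult_cancel_left) simp
    qed (use False assms(3) in auto)
  qed
qed

text \<open>The bound \<open>4 < a\<^sup>2 * d\<close> puts the discriminant
  \<open>- (a\<^sup>2 * d)\<close> below -4, where a form has no proper automorphs except 1 and -1.
  For the three triples it reads 19, 36 and 228.\<close>

context
  fixes a c d M :: int
  assumes a: "a = 1 \<or> a = 2" and d: "a * (d + 1) = 4 * c" "4 < a\<^sup>2 * d"
    and M: "odd M" "0 < M"
begin

text \<open>A common divisor of Y and M divides a X^2; being prime to X it divides a, which is 1 or
  2, while M is odd.\<close>

lemma proper_rep_coprime:
  assumes "(X, Y) \<in> proper_reps a c M"
  shows "coprime Y M"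
proof -
  define g where "g = gcd Y M"
  have e: "a * X\<^sup>2 = M - Y * (a * X + c * Y)" and XY: "coprime X Y"
    using assms by (auto simp: proper_reps_def power2_eq_square algebra_simps)
  have "g dvd a * X\<^sup>2" unfolding e g_def by (intro dvd_diff dvd_mult2) simp_all
  moreover have "coprime g X" using XY unfolding g_def
    by (meson coprime_commute coprime_divisors dvd_refl gcd_dvd1)
  then have "coprime g (X\<^sup>2)" by simp
  ultimately have "g dvd a" by (simp add: coprime_dvd_mult_left_iff)
  moreover have "odd g" using M(1) unfolding g_def by (meson dvd_trans gcd_dvd2)
  ultimately have "g dvd 1"
  proof -
    have "coprime g 2" using \<open>odd g\<close> by (simp add: coprime_right_2_iff_odd)
    then show ?thesis using a \<open>g dvd a\<close> by (metis coprime_dvd_mult_right_iff mult.right_neutral)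
  qed
  then show ?thesis unfolding g_def by (simp add: coprime_iff_gcd_eq_1)
qed

text \<open>The root attached to (X, Y) is (2 X + Y) / Y modulo M, written here without inverting
  Y.\<close>

definition root_reps :: "int \<Rightarrow> (int \<times> int) set"
  where "root_reps r = {(X, Y) \<in> proper_reps a c M. M dvd 2 * X + Y - r * Y}"

lemma odd_coprime_a: "coprime M a"
  using a M(1) by (auto simp: coprime_right_2_iff_odd)

text \<open>By \<open>bqf_norm_identity\<close>, M divides (2 X + Y)^2 + d Y^2, so dividing 2 X + Y
  by the unit Y gives a square root of -d modulo M.\<close>

lemma proper_reps_eq_UN: "proper_reps a c M = (\<Union>r\<in>neg_sqrts d M. root_reps r)"
proof (intro equalityI subsetI)
  fix z assume z: "z \<in> proper_reps a c M"
  obtain X Y where XY: "z = (X, Y)" by force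
  have cop: "coprime Y M" using proper_rep_coprime z XY by simp
  then obtain Y' where Y': "[Y * Y' = 1] (mod M)" using cong_solve_coprime_int by blast
  define r where "r = (2 * X + Y) * Y' mod M"
  have "[r * Y = (2 * X + Y) * Y' * Y] (mod M)"
    unfolding r_def by (intro cong_scalar_right) (simp add: cong_def)
  also have "(2 * X + Y) * Y' * Y = (2 * X + Y) * (Y * Y')" by simp
  also have "[(2 * X + Y) * (Y * Y') = (2 * X + Y) * 1] (mod M)" using Y' by (rule cong_scalar_left)
  finally have rY: "[r * Y = 2 * X + Y] (mod M)" by simp
  have "a * ((2 * X + Y)\<^sup>2 + d * Y\<^sup>2) = 4 * M"
    using bqf_norm_identity[OF d(1), of X Y] z XY by (simp add: proper_reps_def)
  then have "M dvd a * ((2 * X + Y)\<^sup>2 + d * Y\<^sup>2)" by simp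
  then have "M dvd (2 * X + Y)\<^sup>2 + d * Y\<^sup>2"
    using odd_coprime_a by (simp add: coprime_dvd_mult_right_iff)
  moreover have "[(r * Y)\<^sup>2 + d * Y\<^sup>2 = (2 * X + Y)\<^sup>2 + d * Y\<^sup>2] (mod M)"
    using rY by (intro cong_add cong_pow cong_refl)
  ultimately have "M dvd (r * Y)\<^sup>2 + d * Y\<^sup>2" by (simp add: cong_dvd_iff)
  also have "(r * Y)\<^sup>2 + d * Y\<^sup>2 = (r\<^sup>2 + d) * Y\<^sup>2" by (simp add: power2_eq_square algebra_simps)
  finally have "M dvd r\<^sup>2 + d"
    using cop by (metis coprime_commute coprime_dvd_mult_left_iff coprime_power_right_iff)
  moreover have "r \<in> {0..<M}" using M(2) by (simp add: r_def)
  ultimately have "r \<in> neg_sqrts d M" by (simp add: neg_sqrts_def)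
  moreover have "z \<in> root_reps r"
    using z XY cong_sym[OF rY] by (simp add: root_reps_def cong_iff_dvd_diff)
  ultimately show "z \<in> (\<Union>r\<in>neg_sqrts d M. root_reps r)" by blast
qed (auto simp: root_reps_def)

lemma root_reps_disjoint:
  assumes "r \<in> neg_sqrts d M" "s \<in> neg_sqrts d M" "r \<noteq> s"
  shows "root_reps r \<inter> root_reps s = {}"
proof (rule ccontr)
  assume "root_reps r \<inter> root_reps s \<noteq> {}"
  then obtain X Y where XY: "(X, Y) \<in> proper_reps a c M"
    "M dvd 2 * X + Y - r * Y" "M dvd 2 * X + Y - s * Y"
    by (auto simp: root_reps_def)
  have "(2 * X + Y - s * Y) - (2 * X + Y - r * Y) = (r - s) * Y" by (simp add: algebra_simps)
  then have "M dvd (r - s) * Y" using dvd_diff[OF XY(3,2)] by simp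
  then have "M dvd r - s"
    using proper_rep_coprime[OF XY(1)] by (metis coprime_commute coprime_dvd_mult_left_iff)
  then have "r mod M = s mod M" by (simp add: mod_eq_dvd_iff)
  then show False using assms by (simp add: neg_sqrts_def)
qed

text \<open>Two representations with the same root have determinant W divisible by M, whereas 4 M^2
  = B^2 + a^2 d W^2. Since a^2 d > 4, this forces W = 0.\<close>

lemma root_reps_unique:
  assumes "(X, Y) \<in> root_reps r" "(X', Y') \<in> root_reps r"
  shows "(X', Y') = (X, Y) \<or> (X', Y') = (- X, - Y)"
proof (rule coprime_cross_eq)
  show "coprime X Y" "coprime X' Y'" using assms by (auto simp: root_reps_def proper_reps_def)
  define W where "W = X * Y' - X' * Y"
  have "2 * W = (2 * X + Y - r * Y) * Y' - (2 * X' + Y' - r * Y') * Y"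
    unfolding W_def by (simp add: algebra_simps)
  moreover have "M dvd (2 * X + Y - r * Y) * Y' - (2 * X' + Y' - r * Y') * Y"
    using assms unfolding root_reps_def by (blast intro: dvd_diff dvd_mult2)
  ultimately have "M dvd 2 * W" by simp
  then have "M dvd W" using M(1) by (simp add: coprime_dvd_mult_right_iff coprime_right_2_iff_odd)
  then obtain k where k: "W = M * k" by auto
  \<comment> \<open>The polar form of the two vectors; the Gram determinant expresses 4 f(v) f(v') -
    B^2 through W^2.\<close>
  define B where "B = 2 * a * X * X' + a * (X * Y' + X' * Y) + 2 * c * Y * Y'"
  have ac: "4 * a * c - a\<^sup>2 = a\<^sup>2 * d"
    using arg_cong[OF d(1), of "\<lambda>t. a * t"] by (simp add: power2_eq_square algebra_simps)
  have e: "a * X\<^sup>2 + a * X * Y + c * Y\<^sup>2 = M" "a * X'\<^sup>2 + a * X' * Y' + c * Y'\<^sup>2 = M"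
    using assms by (auto simp: root_reps_def proper_reps_def)
  have "4 * (a * X\<^sup>2 + a * X * Y + c * Y\<^sup>2) * (a * X'\<^sup>2 + a * X' * Y' + c * Y'\<^sup>2)
      = B\<^sup>2 + (4 * a * c - a\<^sup>2) * W\<^sup>2"
    unfolding B_def W_def by (simp add: power2_eq_square algebra_simps)
  then have "4 * M\<^sup>2 = B\<^sup>2 + a\<^sup>2 * d * (M * k)\<^sup>2" unfolding e ac k by (simp add: power2_eq_square)
  then have "a\<^sup>2 * d * (M * k)\<^sup>2 \<le> 4 * M\<^sup>2" by simp
  moreover have "4 * M\<^sup>2 < a\<^sup>2 * d * (M * k)\<^sup>2" if "k \<noteq> 0"
  proof -
    have "4 * M\<^sup>2 < a\<^sup>2 * d * M\<^sup>2" using d(2) M(2) by simp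
    also have "\<dots> \<le> a\<^sup>2 * d * (M * k)\<^sup>2"
    proof (rule mult_left_mono)
      have "1 \<le> k\<^sup>2" using that by (simp add: int_one_le_iff_zero_less)
      then show "M\<^sup>2 \<le> (M * k)\<^sup>2" by (simp add: power_mult_distrib mult_le_cancel_left1)
    qed (use d(2) in linarith)
    finally show ?thesis .
  qed
  ultimately have "k = 0" by linarith
  then show "X * Y' = X' * Y" using k W_def by simp
qed

text \<open>With 2 t + 1 = r (mod M), the form has at (t, 1) a value M C. The form with coefficients
  a M, a (2 t + 1), C then has discriminant -a^2 d and takes the value a M at (1, 0), so
  \<open>H\<close> supplies a vector (u, v) of value 1, which is carried back to a vector of value
  M.\<close>

lemma root_reps_nonempty:
  assumes r: "r \<in> neg_sqrts d M"
    and H: "\<And>A B C. 0 < A \<Longrightarrow> B\<^sup>2 - 4 * A * C = - (a\<^sup>2 * d) \<Longrightarrow> a * M \<in> bqf_values A B C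
      \<Longrightarrow> 1 \<in> bqf_values A B C"
  shows "root_reps r \<noteq> {}"
proof -
  \<comment> \<open>The odd number 2 t + 1 can be taken as r or r + M, whichever is odd.\<close>
  obtain t where "M dvd 2 * t + 1 - r"
  proof (cases "even r")
    case True
    then obtain j where "r = 2 * j" by auto
    moreover obtain i where "M = 2 * i + 1" using M(1) by (elim oddE)
    ultimately have "2 * (j + i) + 1 - r = M" by simp
    then show thesis using that[of "j + i"] by simp
  next
    case False
    then obtain j where "r = 2 * j + 1" by (elim oddE)
    then show thesis using that[of j] by simp
  qed
  note t = this
  then have "[2 * t + 1 = r] (mod M)" by (simp add: cong_iff_dvd_diff)
  then have "[(2 * t + 1)\<^sup>2 + d = r\<^sup>2 + d] (mod M)" by (intro cong_add cong_pow cong_refl)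
  then have "M dvd (2 * t + 1)\<^sup>2 + d" using r by (simp add: neg_sqrts_def cong_dvd_iff)
  then have "M dvd a * ((2 * t + 1)\<^sup>2 + d * 1\<^sup>2)" by simp
  then have "M dvd 4 * (a * t\<^sup>2 + a * t * 1 + c * 1\<^sup>2)" unfolding bqf_norm_identity[OF d(1)] .
  then have "M dvd 2 * 2 * (a * t\<^sup>2 + a * t + c)" by simp
  moreover have "coprime M (2 * 2)" using M(1) by (simp only: coprime_mult_right_iff coprime_right_2_iff_odd simp_thms)
  ultimately have "M dvd a * t\<^sup>2 + a * t + c" using coprime_dvd_mult_right_iff by blast
  then obtain C where C: "a * t\<^sup>2 + a * t + c = M * C" by auto
  have ac: "4 * a * c - a\<^sup>2 = a\<^sup>2 * d"
    using arg_cong[OF d(1), of "\<lambda>t. a * t"] by (simp add: power2_eq_square algebra_simps)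
  have "(a * (2 * t + 1))\<^sup>2 - 4 * (a * M) * C = (a * (2 * t + 1))\<^sup>2 - 4 * a * (M * C)" by simp
  also have "\<dots> = - (4 * a * c - a\<^sup>2)" unfolding C[symmetric] by (simp add: power2_eq_square algebra_simps)
  finally have disc: "(a * (2 * t + 1))\<^sup>2 - 4 * (a * M) * C = - (a\<^sup>2 * d)" unfolding ac .
  have "0 < a * M" using a M(2) by auto
  moreover have "a * M \<in> bqf_values (a * M) (a * (2 * t + 1)) C"
    unfolding bqf_values_iff by (intro exI[of _ 1] exI[of _ 0]) simp
  ultimately have "1 \<in> bqf_values (a * M) (a * (2 * t + 1)) C" using H disc by blast
  then obtain u v where uv: "a * M * u\<^sup>2 + a * (2 * t + 1) * u * v + C * v\<^sup>2 = 1"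
    unfolding bqf_values_iff by blast
  \<comment> \<open>The substitution (u, v) -> (t v + M u, v) turns the original form into M times
    the new one.\<close>
  define X where "X = t * v + M * u"
  have "a * X\<^sup>2 + a * X * v + c * v\<^sup>2
      = (a * t\<^sup>2 + a * t + c) * v\<^sup>2 + M * (a * M * u\<^sup>2 + a * (2 * t + 1) * u * v)"
    unfolding X_def by (simp add: power2_eq_square algebra_simps)
  also have "\<dots> = M * (a * M * u\<^sup>2 + a * (2 * t + 1) * u * v + C * v\<^sup>2)"
    unfolding C by (simp add: algebra_simps)
  finally have val: "a * X\<^sup>2 + a * X * v + c * v\<^sup>2 = M" unfolding uv by simp
  \<comment> \<open>A common divisor divides M u and v, hence every term of the new form at (u, v),
    whose value is 1.\<close>
  have "coprime X v"
  proof (rule coprimeI)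
    fix g assume g: "g dvd X" "g dvd v"
    have "g dvd X - t * v" using g by (intro dvd_diff dvd_mult)
    then have "g dvd M * u" by (simp add: X_def)
    then have "g dvd (M * u) * (a * u)" by (rule dvd_mult2)
    moreover have "g dvd v * (a * (2 * t + 1) * u + C * v)" using g(2) by (rule dvd_mult2)
    ultimately have "g dvd (M * u) * (a * u) + v * (a * (2 * t + 1) * u + C * v)" by (rule dvd_add)
    also have "(M * u) * (a * u) + v * (a * (2 * t + 1) * u + C * v)
        = a * M * u\<^sup>2 + a * (2 * t + 1) * u * v + C * v\<^sup>2"
      by (simp add: power2_eq_square algebra_simps)
    also have "\<dots> = 1" by (rule uv)
    finally show "is_unit g" .
  qed
  moreover have "2 * X + v - r * v = (2 * t + 1 - r) * v + M * (2 * u)"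
    unfolding X_def by (simp add: algebra_simps)
  then have "M dvd 2 * X + v - r * v" using t by (metis dvd_add dvd_mult2 dvd_triv_left)
  ultimately have "(X, v) \<in> root_reps r" using val by (simp add: root_reps_def proper_reps_def)
  then show ?thesis by blast
qed

lemma card_root_reps:
  assumes "root_reps r \<noteq> {}"
  shows "card (root_reps r) = 2"
proof -
  obtain X Y where XY: "(X, Y) \<in> root_reps r" using assms by force
  have "- (2 * X + Y - r * Y) = 2 * (- X) + (- Y) - r * (- Y)" by simp
  then have "M dvd 2 * (- X) + (- Y) - r * (- Y)"
    using XY by (metis (no_types, lifting) root_reps_def mem_Collect_eq case_prodD dvd_minus_iff)
  moreover have "(- X, - Y) \<in> proper_reps a c M" using XY by (simp add: root_reps_def proper_reps_def)
  ultimately have "(- X, - Y) \<in> root_reps r" unfolding root_reps_def by blast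
  moreover have "z \<in> {(X, Y), (- X, - Y)}" if "z \<in> root_reps r" for z
    using root_reps_unique[OF XY, of "fst z" "snd z"] that by simp
  ultimately have "root_reps r = {(X, Y), (- X, - Y)}" using XY by blast
  moreover have "(X, Y) \<noteq> (- X, - Y)"
    using XY M(2) by (auto simp: root_reps_def proper_reps_def)
  ultimately show ?thesis by simp
qed

lemma card_proper_reps:
  assumes H: "\<And>A B C. 0 < A \<Longrightarrow> B\<^sup>2 - 4 * A * C = - (a\<^sup>2 * d) \<Longrightarrow> a * M \<in> bqf_values A B C
      \<Longrightarrow> 1 \<in> bqf_values A B C"
  shows "card (proper_reps a c M) = 2 * card (neg_sqrts d M)"
proof -
  have card2: "card (root_reps r) = 2" if "r \<in> neg_sqrts d M" for r
    using card_root_reps root_reps_nonempty[OF that H] by blast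
  then have "\<forall>r\<in>neg_sqrts d M. finite (root_reps r)" by (metis card.infinite zero_neq_numeral)
  then have "card (proper_reps a c M) = (\<Sum>r\<in>neg_sqrts d M. card (root_reps r))"
    unfolding proper_reps_eq_UN using root_reps_disjoint by (intro card_UN_disjoint) auto
  then show ?thesis using card2 by simp
qed

end

section \<open>From primitive to all representations\<close>

definition all_reps :: "int \<Rightarrow> int \<Rightarrow> int \<Rightarrow> (int \<times> int) set"
  where "all_reps a c M = {(X, Y). a * X\<^sup>2 + a * X * Y + c * Y\<^sup>2 = M}"

lemma finite_all_reps:
  assumes "a = 1 \<or> a = 2" "a * (d + 1) = 4 * c" "0 < d"
  shows "finite (all_reps a c M)"
proof (rule finite_subset)
  show "all_reps a c M \<subseteq> {- (8 * \<bar>M\<bar>)..8 * \<bar>M\<bar>} \<times> {- (8 * \<bar>M\<bar>)..8 * \<bar>M\<bar>}"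
  proof clarify
    fix X Y assume "(X, Y) \<in> all_reps a c M"
    then have e: "4 * M = a * ((2 * X + Y)\<^sup>2 + d * Y\<^sup>2)"
      using bqf_norm_identity[OF assms(2), of X Y] by (simp add: all_reps_def)
    have sq: "\<bar>t\<bar> \<le> t\<^sup>2" for t :: int
      using self_le_power[of "\<bar>t\<bar>" 2] by (cases "t = 0") auto
    have "Y\<^sup>2 \<le> d * Y\<^sup>2" using assms(3) by (simp add: mult_le_cancel_right1)
    moreover have "t \<le> a * t" if "0 \<le> t" for t using assms(1) that by auto
    ultimately have "(2 * X + Y)\<^sup>2 + Y\<^sup>2 \<le> 4 * M"
      unfolding e by (smt (verit) zero_le_power2)
    then have "\<bar>2 * X + Y\<bar> \<le> 4 * \<bar>M\<bar>" "\<bar>Y\<bar> \<le> 4 * \<bar>M\<bar>"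
      using sq[of "2 * X + Y"] sq[of Y] by (smt (verit) zero_le_power2)+
    then show "X \<in> {- (8 * \<bar>M\<bar>)..8 * \<bar>M\<bar>} \<and> Y \<in> {- (8 * \<bar>M\<bar>)..8 * \<bar>M\<bar>}" by auto
  qed
qed simp

text \<open>Representations are sorted by the gcd g of their coordinates; dividing by g leaves a
  primitive representation of M / g^2.\<close>

lemma card_all_reps:
  assumes a: "a = 1 \<or> a = 2" and d: "a * (d + 1) = 4 * c" "0 < d" and M: "0 < M"
  shows "card (all_reps a c M) = (\<Sum>g | 0 < g \<and> g\<^sup>2 dvd M. card (proper_reps a c (M div g\<^sup>2)))"
proof -
  define G where "G = {g. 0 < g \<and> g\<^sup>2 dvd M}"
  define S where "S g = (\<lambda>(X, Y). (g * X, g * Y)) ` proper_reps a c (M div g\<^sup>2)" for g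
  have finG: "finite G"
  proof (rule finite_subset)
    show "G \<subseteq> {0..M}"
    proof
      fix g assume "g \<in> G"
      then have "0 < g" "g dvd M" unfolding G_def by (auto dest: dvd_trans[OF dvd_power])
      then show "g \<in> {0..M}" using M by (simp add: zdvd_imp_le)
    qed
  qed simp
  have scale: "a * (g * X)\<^sup>2 + a * (g * X) * (g * Y) + c * (g * Y)\<^sup>2
      = g\<^sup>2 * (a * X\<^sup>2 + a * X * Y + c * Y\<^sup>2)" for g X Y
    by (simp add: power2_eq_square algebra_simps)
  have UN: "all_reps a c M = (\<Union>g\<in>G. S g)"
  proof (intro equalityI subsetI)
    fix z assume z: "z \<in> all_reps a c M"
    obtain X Y where XY: "z = (X, Y)" by force
    define g where "g = gcd X Y"
    have "X \<noteq> 0 \<or> Y \<noteq> 0" using z XY M by (auto simp: all_reps_def)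
    then have g: "0 < g" by (auto simp: g_def)
    obtain X' Y' where X': "X = g * X'" "Y = g * Y'" "coprime X' Y'"
      using gcd_coprime_exists[of X Y] g unfolding g_def by (auto simp: mult.commute)
    have e: "M = g\<^sup>2 * (a * X'\<^sup>2 + a * X' * Y' + c * Y'\<^sup>2)"
      using z XY X'(1,2) scale[of g X' Y'] by (simp add: all_reps_def)
    then have "g \<in> G" "M div g\<^sup>2 = a * X'\<^sup>2 + a * X' * Y' + c * Y'\<^sup>2" using g by (simp_all add: G_def)
    then have "(X', Y') \<in> proper_reps a c (M div g\<^sup>2)" using X'(3) by (simp add: proper_reps_def)
    then show "z \<in> (\<Union>g\<in>G. S g)" using XY X' \<open>g \<in> G\<close> unfolding S_def by force
  next
    fix z assume "z \<in> (\<Union>g\<in>G. S g)"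
    then obtain g X Y where g: "g \<in> G" "(X, Y) \<in> proper_reps a c (M div g\<^sup>2)" "z = (g * X, g * Y)"
      by (auto simp: S_def)
    then show "z \<in> all_reps a c M" using scale[of g X Y] by (simp add: all_reps_def proper_reps_def G_def)
  qed
  have gcdS: "gcd X Y = g" if "(X, Y) \<in> S g" "g \<in> G" for X Y g
    using that by (auto simp: S_def G_def proper_reps_def gcd_mult_left coprime_iff_gcd_eq_1)
  have disj: "S g \<inter> S h = {}" if "g \<in> G" "h \<in> G" "g \<noteq> h" for g h
  proof (rule ccontr)
    assume "S g \<inter> S h \<noteq> {}"
    then obtain X Y where "(X, Y) \<in> S g" "(X, Y) \<in> S h" by force
    then show False using gcdS that by metis
  qed
  have fin: "finite (S g)" if "g \<in> G" for g
  proof (rule finite_subset)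
    show "S g \<subseteq> all_reps a c M" unfolding UN using that by (rule UN_upper)
    show "finite (all_reps a c M)" using a d by (rule finite_all_reps)
  qed
  have cardS: "card (S g) = card (proper_reps a c (M div g\<^sup>2))" if "g \<in> G" for g
    unfolding S_def by (rule card_image) (use that in \<open>auto simp: inj_on_def G_def\<close>)
  have "card (all_reps a c M) = (\<Sum>g\<in>G. card (S g))"
    unfolding UN using finG fin disj by (intro card_UN_disjoint) auto
  also have "\<dots> = (\<Sum>g\<in>G. card (proper_reps a c (M div g\<^sup>2)))" using cardS by simp
  finally show ?thesis by (simp only: G_def)
qed

text \<open>As 5 is a unit modulo 12, so is g, and every unit modulo 12 has square 1.\<close>

lemma div_square_mod_12:
  fixes M g :: int
  assumes "M mod 12 = 5" "g\<^sup>2 dvd M"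
  shows "(M div g\<^sup>2) mod 12 = 5"
proof -
  obtain m where m: "M = g\<^sup>2 * m" using assms(2) by auto
  have "g \<noteq> 0" using m assms(1) by auto
  then have dv: "M div g\<^sup>2 = m" using m by simp
  have "g mod 12 \<in> {0, 1, 2, 3, 4, 5, 6, 7, 8, 9, 10, 11}" by simp presburger
  then have "(g mod 12)\<^sup>2 mod 12 \<in> {0, 1, 4, 9}" by (elim insertE emptyE) simp_all
  then have "g\<^sup>2 mod 12 \<in> {0, 1, 4, 9}" by (simp add: power_mod)
  moreover have "(g\<^sup>2 mod 12) * m mod 12 = 5"
    using assms(1) unfolding m by (simp add: mod_mult_left_eq)
  ultimately have "m mod 12 = 5" by (elim insertE emptyE) (simp_all, presburger+)
  then show ?thesis using dv by simp
qed

lemma eight_dvd_sum_all_reps: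
  assumes "0 < M" "M mod 12 = 5"
  shows "8 dvd card (all_reps 1 5 M) + card (all_reps 2 5 M) + card (all_reps 2 29 M)"
proof -
  have "8 dvd card (proper_reps 1 5 m) + card (proper_reps 2 5 m) + card (proper_reps 2 29 m)"
    if g: "0 < g" "g\<^sup>2 dvd M" and m: "m = M div g\<^sup>2" for g m
  proof -
    have m12: "m mod 12 = 5" unfolding m using assms(2) g(2) by (rule div_square_mod_12)
    have "0 \<le> m" unfolding m using assms(1) by (simp add: div_int_pos_iff)
    then have mpos: "0 < m" using m12 by (cases "m = 0") auto
    have modd: "odd m" using m12 by presburger
    have "card (proper_reps 1 5 m) = 2 * card (neg_sqrts 19 m)"
      using modd mpos bqf_represents_one_19 by (intro card_proper_reps) auto
    moreover have "card (proper_reps 2 5 m) = 2 * card (neg_sqrts 9 m)"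
      using modd mpos bqf_represents_one_36[OF _ _ _ m12] by (intro card_proper_reps) auto
    moreover have "card (proper_reps 2 29 m) = 2 * card (neg_sqrts 57 m)"
      using modd mpos bqf_represents_one_228[OF _ _ _ m12] by (intro card_proper_reps) auto
    moreover have "4 dvd card (neg_sqrts 19 m) + card (neg_sqrts 9 m) + card (neg_sqrts 57 m)"
      using mpos m12 by (rule four_dvd_sum_card_neg_sqrts)
    ultimately show ?thesis by presburger
  qed
  then have "8 dvd (\<Sum>g | 0 < g \<and> g\<^sup>2 dvd M. card (proper_reps 1 5 (M div g\<^sup>2))
      + card (proper_reps 2 5 (M div g\<^sup>2)) + card (proper_reps 2 29 (M div g\<^sup>2)))"
    by (intro dvd_sum) auto
  moreover have "card (all_reps 1 5 M) = (\<Sum>g | 0 < g \<and> g\<^sup>2 dvd M. card (proper_reps 1 5 (M div g\<^sup>2)))"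
    by (rule card_all_reps[of 1 19]) (use assms in auto)
  moreover have "card (all_reps 2 5 M) = (\<Sum>g | 0 < g \<and> g\<^sup>2 dvd M. card (proper_reps 2 5 (M div g\<^sup>2)))"
    by (rule card_all_reps[of 2 9]) (use assms in auto)
  moreover have "card (all_reps 2 29 M) = (\<Sum>g | 0 < g \<and> g\<^sup>2 dvd M. card (proper_reps 2 29 (M div g\<^sup>2)))"
    by (rule card_all_reps[of 2 57]) (use assms in auto)
  ultimately show ?thesis by (simp add: sum.distrib)
qed

section \<open>Positive solutions of the diagonal equations\<close>

lemma card_sign_quadruple:
  fixes P :: "nat \<Rightarrow> nat \<Rightarrow> bool"
  assumes "\<And>x y. P x y \<Longrightarrow> 0 < x \<and> 0 < y"
  shows "card {(x::int, y::int). P (nat \<bar>x\<bar>) (nat \<bar>y\<bar>)} = 4 * card {(x, y). P x y}"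
proof -
  define f :: "(nat \<times> nat) \<times> (int \<times> int) \<Rightarrow> int \<times> int"
    where "f = (\<lambda>((x, y), (s, t)). (s * int x, t * int y))"
  define f' :: "int \<times> int \<Rightarrow> (nat \<times> nat) \<times> (int \<times> int)"
    where "f' = (\<lambda>(x, y). ((nat \<bar>x\<bar>, nat \<bar>y\<bar>), (sgn x, sgn y)))"
  define A where "A = {(x, y). P x y} \<times> ({-1, 1::int} \<times> {-1, 1::int})"
  define B where "B = {(x::int, y::int). P (nat \<bar>x\<bar>) (nat \<bar>y\<bar>)}"
  have "bij_betw f A B"
  proof (rule bij_betw_byWitness[where f' = f'])
    show "\<forall>z\<in>A. f' (f z) = z"
      using assms by (auto simp: A_def f_def f'_def sgn_mult)
    show "\<forall>z\<in>B. f (f' z) = z"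
      by (auto simp: B_def f_def f'_def sgn_mult_abs)
    show "f ` A \<subseteq> B" by (auto simp: A_def B_def f_def)
    show "f' ` B \<subseteq> A"
    proof (intro image_subsetI)
      fix z assume "z \<in> B"
      then obtain x y where z: "z = (x, y)" and P: "P (nat \<bar>x\<bar>) (nat \<bar>y\<bar>)"
        by (auto simp: B_def)
      then have "x \<noteq> 0" "y \<noteq> 0" using assms by fastforce+
      then show "f' z \<in> A" using P z by (auto simp: sgn_if A_def f'_def)
    qed
  qed
  then have "card B = card A" by (simp add: bij_betw_same_card)
  then show ?thesis unfolding A_def B_def by (simp add: card_cartesian_product)
qed

text \<open>The substitution x = 2 X + Y, y = Y diagonalises the form. Its condition x = y (mod 2)
  is automatic, since x^2 + d y^2 is even and d odd. By \<open>pos\<close> no coordinate vanishes,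
  so sign changes have orbits of size four.\<close>

lemma card_all_reps_eq_positive:
  assumes a: "a = 1 \<or> a = 2" and d: "a * (int d + 1) = 4 * c" "odd d"
    and pos: "\<And>x y. a * int (x\<^sup>2 + d * y\<^sup>2) = 4 * M \<Longrightarrow> 0 < x \<and> 0 < y"
  shows "card (all_reps a c M) = 4 * card {(x, y). a * int (x\<^sup>2 + d * y\<^sup>2) = 4 * M}"
proof -
  let ?S = "{(x::int, y::int). a * int ((nat \<bar>x\<bar>)\<^sup>2 + d * (nat \<bar>y\<bar>)\<^sup>2) = 4 * M}"
  have S: "?S = {(x, y). a * (x\<^sup>2 + int d * y\<^sup>2) = 4 * M}" by simp
  have "bij_betw (\<lambda>(X, Y). (2 * X + Y, Y)) (all_reps a c M) ?S"
    unfolding S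
  proof (rule bij_betw_imageI)
    show "inj_on (\<lambda>(X, Y). (2 * X + Y, Y)) (all_reps a c M)" by (auto simp: inj_on_def)
    show "(\<lambda>(X, Y). (2 * X + Y, Y)) ` all_reps a c M = {(x, y). a * (x\<^sup>2 + int d * y\<^sup>2) = 4 * M}"
    proof (intro equalityI subsetI)
      fix z assume "z \<in> (\<lambda>(X, Y). (2 * X + Y, Y)) ` all_reps a c M"
      then show "z \<in> {(x, y). a * (x\<^sup>2 + int d * y\<^sup>2) = 4 * M}"
        using bqf_norm_identity[OF d(1)] by (auto simp: all_reps_def)
    next
      fix z assume "z \<in> {(x, y). a * (x\<^sup>2 + int d * y\<^sup>2) = 4 * M}"
      then obtain x y where xy: "z = (x, y)" "a * (x\<^sup>2 + int d * y\<^sup>2) = 4 * M" by auto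
      have "even (x\<^sup>2 + int d * y\<^sup>2)"
      proof -
        have "x\<^sup>2 + int d * y\<^sup>2 = 2 * (2 * M) \<or> x\<^sup>2 + int d * y\<^sup>2 = 2 * M" using a xy(2) by auto
        then show ?thesis by (metis dvd_triv_left)
      qed
      then have "even (x - y)" using d(2) by auto
      then obtain X where X: "x = 2 * X + y" by (metis add.commute diff_add_cancel dvdE)
      have "4 * (a * X\<^sup>2 + a * X * y + c * y\<^sup>2) = 4 * M"
        using bqf_norm_identity[OF d(1), of X y] xy(2) X by simp
      then have "(X, y) \<in> all_reps a c M" by (simp add: all_reps_def)
      then show "z \<in> (\<lambda>(X, Y). (2 * X + Y, Y)) ` all_reps a c M" using xy(1) X by force
    qed
  qed
  then have "card (all_reps a c M) = card ?S" by (rule bij_betw_same_card)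
  also have "\<dots> = 4 * card {(x, y). a * int (x\<^sup>2 + d * y\<^sup>2) = 4 * M}"
    using pos by (rule card_sign_quadruple)
  finally show ?thesis .
qed

lemma even_sum_reps:
  fixes M :: nat
  assumes "M mod 12 = 5"
  shows "even (card {(x, y). x\<^sup>2 + 19 * y\<^sup>2 = 4 * M} + card {(x, y). x\<^sup>2 + 9 * y\<^sup>2 = 2 * M}
    + card {(x, y). x\<^sup>2 + 57 * y\<^sup>2 = 2 * M})"
proof -
  have sq3: "x\<^sup>2 mod 3 \<noteq> 2" for x :: nat
  proof -
    have "x mod 3 = 0 \<or> x mod 3 = 1 \<or> x mod 3 = 2" by presburger
    then have "(x mod 3)\<^sup>2 mod 3 \<noteq> 2" by (elim disjE) simp_all
    then show ?thesis by (simp add: power_mod)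
  qed
  have sq4: "x\<^sup>2 mod 4 \<noteq> 3" "x\<^sup>2 mod 4 \<noteq> 2" for x :: nat
  proof -
    have "x mod 4 = 0 \<or> x mod 4 = 1 \<or> x mod 4 = 2 \<or> x mod 4 = 3" by presburger
    then have "(x mod 4)\<^sup>2 mod 4 \<noteq> 3 \<and> (x mod 4)\<^sup>2 mod 4 \<noteq> 2" by (elim disjE) simp_all
    then show "x\<^sup>2 mod 4 \<noteq> 3" "x\<^sup>2 mod 4 \<noteq> 2" by (simp_all add: power_mod)
  qed
  have e: "int M mod 12 = 5" using assms by presburger
  have M3: "M mod 3 = 2" and M4: "M mod 4 = 1" using assms by presburger+
  \<comment> \<open>The case x = 0 fails modulo 4 after halving y, the case y = 0 fails modulo
    3.\<close>
  have pos19: "0 < x \<and> 0 < y" if "x\<^sup>2 + 19 * y\<^sup>2 = 4 * M" for x y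
  proof -
    have "x \<noteq> 0"
    proof
      assume "x = 0"
      then have e: "19 * y\<^sup>2 = 4 * M" using that by simp
      then have "even (19 * y\<^sup>2)" by simp
      then have "even y" by simp
      then obtain z where "y = 2 * z" by auto
      then have "M = 19 * z\<^sup>2" using e by simp
      then have "z\<^sup>2 mod 4 = 3" using M4 by presburger
      then show False using sq4(1) by blast
    qed
    moreover have "y \<noteq> 0"
    proof
      assume "y = 0"
      then have "x\<^sup>2 = 4 * M" using that by simp
      then have "x\<^sup>2 mod 3 = 2" using M3 by presburger
      then show False using sq3 by blast
    qed
    ultimately show ?thesis by simp
  qed
  \<comment> \<open>The values k = 3 and k = 19 give the coefficients 9 and 57. Here x = 0 fails
    modulo 3 and y = 0 modulo 4.\<close>
  have pos2: "0 < x \<and> 0 < y" if "x\<^sup>2 + 3 * (k * y\<^sup>2) = 2 * M" for x y k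
  proof -
    have "x \<noteq> 0"
    proof
      assume "x = 0"
      then have "3 dvd 2 * M" using that by (metis dvd_triv_left add_0 power_zero_numeral)
      then show False using M3 by presburger
    qed
    moreover have "y \<noteq> 0"
    proof
      assume "y = 0"
      then have "x\<^sup>2 = 2 * M" using that by simp
      then have "x\<^sup>2 mod 4 = 2" using M4 by presburger
      then show False using sq4(2) by blast
    qed
    ultimately show ?thesis by simp
  qed
  have A: "card (all_reps 1 5 (int M)) = 4 * card {(x, y). x\<^sup>2 + 19 * y\<^sup>2 = 4 * M}"
  proof -
    have iff: "1 * int t = 4 * int M \<longleftrightarrow> t = 4 * M" for t by presburger
    show ?thesis
      using card_all_reps_eq_positive[of 1 19 5 "int M"] pos19 unfolding iff by simp
  qed
  have B: "card (all_reps 2 5 (int M)) = 4 * card {(x, y). x\<^sup>2 + 9 * y\<^sup>2 = 2 * M}"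
  proof -
    have iff: "2 * int t = 4 * int M \<longleftrightarrow> t = 2 * M" for t by presburger
    show ?thesis
      using card_all_reps_eq_positive[of 2 9 5 "int M"] pos2[of _ 3] unfolding iff by simp
  qed
  have C: "card (all_reps 2 29 (int M)) = 4 * card {(x, y). x\<^sup>2 + 57 * y\<^sup>2 = 2 * M}"
  proof -
    have iff: "2 * int t = 4 * int M \<longleftrightarrow> t = 2 * M" for t by presburger
    show ?thesis
      using card_all_reps_eq_positive[of 2 57 29 "int M"] pos2[of _ 19] unfolding iff by simp
  qed
  have "0 < int M" using assms by (cases "M = 0") auto
  then show ?thesis using eight_dvd_sum_all_reps[OF _ e] unfolding A B C by presburger
qed

section \<open>Power series modulo 2\<close>

text \<open>These rules would rewrite the ring operations into bitwise ones.\<close>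

declare add_bit_eq_xor [simp del] mult_bit_eq_and [simp del]

lemma bit_add_self [simp]: "(a::bit) + a = 0"
  by (cases a) (simp_all add: one_add_one)

lemma of_nat_bit_eq_iff: "(of_nat m :: bit) = of_nat n \<longleftrightarrow> even (m + n)"
proof -
  have "(of_nat k :: bit) = of_bool (odd k)" for k
    by (induction k) auto
  then show ?thesis by auto
qed

lemma fps_bit_add_self [simp]: "(F :: bit fps) + F = 0"
  by (rule fps_ext) (simp only: fps_add_nth bit_add_self fps_zero_nth)

text \<open>Frobenius in characteristic 2: the terms i and n - i cancel in pairs, leaving the
  diagonal i = n / 2.\<close>

lemma fps_bit_square_nth:
  fixes F :: "bit fps"
  shows "fps_nth (F * F) n = (if even n then fps_nth F (n div 2) else 0)"
proof -
  let ?h = "\<lambda>i. fps_nth F i * fps_nth F (n - i)"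
  define A where "A = {i. 2 * i < n}"
  define B where "B = {i. n < 2 * i \<and> i \<le> n}"
  define C where "C = {i. 2 * i = n}"
  have fin: "finite A" "finite B" "finite C"
    by (rule finite_subset[of _ "{..n}"]; auto simp: A_def B_def C_def)+
  have "{0..n} = (A \<union> B) \<union> C" "A \<inter> B = {}" "(A \<union> B) \<inter> C = {}"
    by (auto simp: A_def B_def C_def)
  then have "fps_nth (F * F) n = sum ?h A + sum ?h B + sum ?h C"
    using fin by (simp add: fps_mult_nth sum.union_disjoint)
  also have "sum ?h B = sum ?h A"
    by (rule sum.reindex_bij_witness[where i = "\<lambda>i. n - i" and j = "\<lambda>i. n - i"])
      (auto simp: A_def B_def mult.commute)
  also have "sum ?h C = (if even n then fps_nth F (n div 2) else 0)"
  proof (cases "even n")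
    case True
    then have "C = {n div 2}" "n - n div 2 = n div 2" by (auto simp: C_def)
    moreover have "(a::bit) * a = a" for a by (cases a) simp_all
    ultimately show ?thesis using True by simp
  next
    case False
    then have "C = {}" by (auto simp: C_def)
    then show ?thesis using False by simp
  qed
  finally show ?thesis by simp
qed

section \<open>Partitions into parts from a finite set\<close>

lemma member_le_sum_mset: "x \<in># p \<Longrightarrow> x \<le> sum_mset p" for x :: nat
  by (auto dest: multi_member_split)

lemma finite_mset_sum_eq:
  fixes S :: "nat set"
  assumes "0 \<notin> S"
  shows "finite {p. set_mset p \<subseteq> S \<and> sum_mset p = n}"
proof (rule finite_subset)
  have len: "size p \<le> sum_mset p" if "0 \<notin># p" for p :: "nat multiset"
    using that by (induction p) auto
  show "{p. set_mset p \<subseteq> S \<and> sum_mset p = n} \<subseteq> mset ` {xs. set xs \<subseteq> {..n} \<and> length xs \<le> n}"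
  proof clarify
    fix p assume p: "set_mset p \<subseteq> S" "n = sum_mset p"
    obtain xs where xs: "mset xs = p" using ex_mset by blast
    have "0 \<notin># p" using p(1) assms by blast
    then have "size p \<le> sum_mset p" by (rule len)
    then have "length xs \<le> sum_mset p" using xs by auto
    moreover have "set xs \<subseteq> {..sum_mset p}" using xs member_le_sum_mset by fastforce
    ultimately show "p \<in> mset ` {xs. set xs \<subseteq> {..sum_mset p} \<and> length xs \<le> sum_mset p}"
      using xs by blast
  qed
  show "finite (mset ` {xs. set xs \<subseteq> {..n} \<and> length xs \<le> n})"
    by (intro finite_imageI finite_lists_length_le) simp
qed

text \<open>Coefficients lie in \<open>bit\<close> from the start, so that the Euler factor 1 - q^j
  becomes 1 + q^j.\<close>

definition partition_fps :: "nat set \<Rightarrow> bit fps"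
  where "partition_fps S = Abs_fps (\<lambda>n. of_nat (card {p. set_mset p \<subseteq> S \<and> sum_mset p = n}))"

text \<open>A multiset of parts either avoids j or arises by adding one copy of j.\<close>

lemma partition_fps_insert:
  assumes "0 \<notin> insert j S" "j \<notin> S"
  shows "partition_fps (insert j S) = partition_fps S + fps_X ^ j * partition_fps (insert j S)"
proof (rule fps_ext)
  fix n
  define A where "A n = {p. set_mset p \<subseteq> insert j S \<and> sum_mset p = n}" for n
  define B where "B = {p. set_mset p \<subseteq> S \<and> sum_mset p = n}"
  define C where "C = {p \<in> A n. j \<in># p}"
  have fin: "finite (A n)" "finite B"
    unfolding A_def B_def using assms by (auto intro!: finite_mset_sum_eq)
  have "A n = B \<union> C" "B \<inter> C = {}" using assms(2) by (auto simp: A_def B_def C_def)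
  then have "card (A n) = card B + card C"
    using fin by (metis card_Un_disjoint finite_Un)
  moreover have "card C = (if n < j then 0 else card (A (n - j)))"
  proof (cases "n < j")
    case True
    have "C = {}"
    proof (rule ccontr)
      assume "C \<noteq> {}"
      then obtain p where "j \<in># p" "sum_mset p = n" by (auto simp: C_def A_def)
      then show False using True member_le_sum_mset[of j p] by simp
    qed
    then show ?thesis using True by simp
  next
    case False
    have "C = add_mset j ` A (n - j)"
    proof (intro equalityI subsetI)
      fix p assume p: "p \<in> C"
      then obtain q where q: "p = add_mset j q" by (auto simp: C_def dest: multi_member_split)
      then have "q \<in> A (n - j)" using p by (auto simp: C_def A_def)
      then show "p \<in> add_mset j ` A (n - j)" using q by blast
    qed (use False in \<open>auto simp: C_def A_def\<close>)
    then show ?thesis using False by (simp add: card_image inj_on_def)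
  qed
  ultimately have "card (A n) = card B + (if n < j then 0 else card (A (n - j)))" by simp
  then show "fps_nth (partition_fps (insert j S)) n
      = fps_nth (partition_fps S + fps_X ^ j * partition_fps (insert j S)) n"
    by (simp add: partition_fps_def fps_X_power_mult_nth A_def B_def)
qed

lemma partition_fps_mult_prod:
  assumes "finite S" "0 \<notin> S"
  shows "partition_fps S * (\<Prod>j\<in>S. 1 + fps_X ^ j) = 1"
  using assms
proof (induction S rule: finite_induct)
  case empty
  have "{p. set_mset p \<subseteq> {} \<and> sum_mset p = n} = (if n = 0 then {{#}} else {})" for n :: nat by auto
  then show ?case by (simp add: partition_fps_def fps_eq_iff)
next
  case (insert j S)
  define H where "H = fps_X ^ j * partition_fps (insert j S)"
  have "partition_fps (insert j S) = partition_fps S + H"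
    using partition_fps_insert[of j S] insert.hyps insert.prems by (simp add: H_def)
  then have "partition_fps (insert j S) + H = partition_fps S" by (simp add: add.assoc)
  then have "partition_fps (insert j S) * (1 + fps_X ^ j) = partition_fps S"
    by (simp add: H_def distrib_left mult.commute)
  then show ?case using insert by (simp add: mult.assoc[symmetric])
qed

text \<open>With \<open>e\<close> the exponent of \<open>q\<close>, \<open>quad_series 1 1\<close> is \<open>f\<^sub>1\<close>, \<open>quad_series 9 9\<close> is \<open>\<psi>(q\<^sup>3)\<close>,
  \<open>quad_series 9 57\<close> is \<open>q\<^sup>2 \<psi>(q^19)\<close> and \<open>quad_series 8 152\<close> is \<open>q\<^sup>6 W(q^19)\<close>.\<close>

definition quad_series :: "nat \<Rightarrow> nat \<Rightarrow> bit fps"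
  where "quad_series r k = Abs_fps (\<lambda>e. of_bool (\<exists>x::nat. 24 * e + r = k * x\<^sup>2))"

section \<open>The pentagonal number theorem modulo 2\<close>

definition tri :: "nat \<Rightarrow> nat"
  where "tri k = k * (k + 1) div 2"

lemma tri_0 [simp]: "tri 0 = 0" by (simp add: tri_def)

lemma tri_Suc: "tri (Suc k) = tri k + Suc k"
  by (simp add: tri_def)

lemma two_mult_tri: "2 * tri k = k * (k + 1)"
  by (simp add: tri_def)

definition tail_prod :: "nat \<Rightarrow> nat \<Rightarrow> bit fps"
  where "tail_prod k n = (\<Prod>j\<in>{k<..n}. 1 + fps_X ^ j)"

text \<open>Shanks' finite form of Euler's pentagonal number theorem: the sum telescopes in \<open>n\<close>, and modulo
  \<open>q^(n+1)\<close> only its term \<open>k = 0\<close>, the Euler product, survives.\<close>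

definition shanks_sum :: "nat \<Rightarrow> bit fps"
  where "shanks_sum n = (\<Sum>k\<le>n. tail_prod k n * fps_X ^ (k * n + tri k))"

lemma tail_prod_Suc_right: "k \<le> n \<Longrightarrow> tail_prod k (Suc n) = tail_prod k n * (1 + fps_X ^ Suc n)"
proof -
  assume "k \<le> n"
  then have "{k<..Suc n} = insert (Suc n) {k<..n}" by auto
  then show ?thesis by (simp add: tail_prod_def mult.commute)
qed

lemma tail_prod_Suc_left: "k < n \<Longrightarrow> tail_prod (Suc k) n * (1 + fps_X ^ Suc k) = tail_prod k n"
proof -
  assume "k < n"
  then have "{k<..n} = insert (Suc k) {Suc k<..n}" by auto
  then show ?thesis by (simp add: tail_prod_def mult.commute del: power_Suc)
qed

lemma tail_prod_same [simp]: "tail_prod n n = 1"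
  by (simp add: tail_prod_def)

lemma sum_telescope_bit_fps:
  fixes U V :: "nat \<Rightarrow> bit fps"
  assumes "V 0 = 0" "\<And>k. k < n \<Longrightarrow> V (Suc k) = U k"
  shows "(\<Sum>k\<le>n. V k + U k) = U n"
  using assms(2)
proof (induction n)
  case 0 then show ?case using assms(1) by simp
next
  case (Suc n)
  then have "(\<Sum>k\<le>n. V k + U k) = U n" by simp
  moreover have "U n + (U n + U (Suc n)) = U (Suc n)"
    by (simp flip: add.assoc)
  ultimately show ?case using Suc.prems[of n] by simp
qed

text \<open>Raising n by one multiplies the tail product by 1 + q^(n+1) and the power by q^k. The
  correction to the k-th term is V k + U k with V (k + 1) = U k, so it telescopes to U n. With the
  new top term, this adds the exponents m (3 m - 1) / 2 and m (3 m + 1) / 2 for m = n + 1.\<close>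

lemma shanks_sum_Suc:
  "shanks_sum (Suc n) = shanks_sum n + (fps_X ^ (Suc n * Suc n + tri n) + fps_X ^ (Suc n * Suc n + tri (Suc n)))"
proof -
  define U where "U k = tail_prod k n * fps_X ^ (Suc k * Suc n + tri k)" for k
  define V where "V k = tail_prod k n * (1 + fps_X ^ k) * fps_X ^ (k * n + tri k)" for k
  define W where "W k = tail_prod k n * fps_X ^ (k * n + tri k)" for k
  have step: "tail_prod k (Suc n) * fps_X ^ (k * Suc n + tri k) = W k + (V k + U k)" if "k \<le> n" for k
  proof -
    have "tail_prod k (Suc n) * fps_X ^ (k * Suc n + tri k)
        = tail_prod k n * fps_X ^ (k * n + k + tri k) + U k"
      using that by (simp add: tail_prod_Suc_right U_def algebra_simps power_add)
    moreover have "V k = W k + tail_prod k n * fps_X ^ (k * n + k + tri k)"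
      by (simp add: V_def W_def algebra_simps power_add)
    then have "W k + V k = tail_prod k n * fps_X ^ (k * n + k + tri k)"
      by (simp flip: add.assoc)
    ultimately show ?thesis by (simp flip: add.assoc)
  qed
  have "(\<Sum>k\<le>n. V k + U k) = U n"
  proof (rule sum_telescope_bit_fps)
    show "V 0 = 0" by (simp add: V_def)
    fix k assume "k < n"
    then have "V (Suc k) = tail_prod k n * fps_X ^ (Suc k * n + tri (Suc k))"
      unfolding V_def by (simp only: tail_prod_Suc_left)
    also have "Suc k * n + tri (Suc k) = Suc k * Suc n + tri k" by (simp add: tri_Suc)
    finally show "V (Suc k) = U k" by (simp add: U_def)
  qed
  moreover have "shanks_sum (Suc n) = (\<Sum>k\<le>n. W k + (V k + U k)) + fps_X ^ (Suc n * Suc n + tri (Suc n))"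
    unfolding shanks_sum_def using step by simp
  moreover have "shanks_sum n = (\<Sum>k\<le>n. W k)" by (simp add: shanks_sum_def W_def)
  ultimately show ?thesis by (simp only: sum.distrib) (simp add: U_def add.assoc)
qed

lemma square_eq_24_residue:
  fixes x e :: nat
  assumes "24 * e + 1 = x\<^sup>2"
  shows "odd x" "\<not> 3 dvd x"
proof -
  have "odd (x\<^sup>2)" unfolding assms[symmetric] by simp
  then show "odd x" by simp
  show "\<not> 3 dvd x"
  proof
    assume "3 dvd x"
    then have "3 dvd 24 * e + 1" unfolding assms by (simp add: power2_eq_square)
    then show False by presburger
  qed
qed

text \<open>For e = m (3 m - 1) / 2 or m (3 m + 1) / 2, 24 e + 1 is the square of 6 m - 1 or 6 m +
  1. So the pentagonal exponents with m \<le> n are those whose root is at most 6 n + 1.\<close>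

lemma shanks_sum_nth: "fps_nth (shanks_sum n) e = of_bool (\<exists>x\<le>6 * n + 1. 24 * e + 1 = x\<^sup>2)"
proof (induction n)
  case 0
  have "(\<exists>x\<le>1. 24 * e + 1 = x\<^sup>2) \<longleftrightarrow> e = 0"
  proof
    assume "\<exists>x\<le>1. 24 * e + 1 = x\<^sup>2"
    then obtain x where "x \<le> 1" "24 * e + 1 = x\<^sup>2" by blast
    moreover have "x\<^sup>2 \<le> 1\<^sup>2" using \<open>x \<le> 1\<close> by (intro power_mono) auto
    ultimately show "e = 0" by simp
  qed (auto intro: exI[of _ 1])
  then show ?case by (simp add: shanks_sum_def)
next
  case (Suc n)
  define e1 where "e1 = Suc n * Suc n + tri n"
  define e2 where "e2 = Suc n * Suc n + tri (Suc n)"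
  have e1: "24 * e1 + 1 = (6 * n + 5)\<^sup>2"
    using two_mult_tri[of n] unfolding e1_def by (simp add: power2_eq_square algebra_simps)
  have e2: "24 * e2 + 1 = (6 * n + 7)\<^sup>2"
    using two_mult_tri[of "Suc n"] unfolding e2_def by (simp add: power2_eq_square algebra_simps)
  have ne: "e1 \<noteq> e2" by (simp add: e1_def e2_def tri_Suc)
  have inj: "x = y" if "24 * e + 1 = x\<^sup>2" "24 * e + 1 = y\<^sup>2" for x y :: nat
    using that by (metis power2_eq_imp_eq zero_le)
  have iff: "(\<exists>x\<le>6 * Suc n + 1. 24 * e + 1 = x\<^sup>2)
      \<longleftrightarrow> (\<exists>x\<le>6 * n + 1. 24 * e + 1 = x\<^sup>2) \<or> e = e1 \<or> e = e2" (is "?L \<longleftrightarrow> ?R")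
  proof
    assume ?L
    then obtain x where x: "x \<le> 6 * n + 7" "24 * e + 1 = x\<^sup>2" by auto
    \<comment> \<open>Among the new candidates 6 n + 2, ..., 6 n + 7 only two are prime to
      6.\<close>
    have "x \<le> 6 * n + 1 \<or> x = 6 * n + 5 \<or> x = 6 * n + 7"
      using x(1) square_eq_24_residue[OF x(2)] by presburger
    then show ?R using x(2) e1 e2 by auto
  next
    assume ?R
    then show ?L
    proof (elim disjE)
      assume "\<exists>x\<le>6 * n + 1. 24 * e + 1 = x\<^sup>2"
      then show ?L by (meson add_le_mono1 le_trans mult_le_mono2 le_SucI order_refl)
    next
      assume "e = e1"
      then show ?L using e1 by (intro exI[of _ "6 * n + 5"]) simp
    next
      assume "e = e2"
      then show ?L using e2 by (intro exI[of _ "6 * n + 7"]) simp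
    qed
  qed
  have "e \<noteq> e1 \<and> e \<noteq> e2" if ex: "\<exists>x\<le>6 * n + 1. 24 * e + 1 = x\<^sup>2"
    using ex
  proof (elim exE conjE)
    fix x assume x: "x \<le> 6 * n + 1" "24 * e + 1 = x\<^sup>2"
    have "x = 6 * n + 5" if "e = e1" using e1 that by (intro inj[OF x(2)]) simp
    moreover have "x = 6 * n + 7" if "e = e2" using e2 that by (intro inj[OF x(2)]) simp
    ultimately show ?thesis using x(1) by auto
  qed
  then show ?case
    unfolding iff shanks_sum_Suc fps_add_nth Suc.IH fps_X_power_nth e1_def[symmetric] e2_def[symmetric]
    using ne by (cases "\<exists>x\<le>6 * n + 1. 24 * e + 1 = x\<^sup>2"; cases "e = e1"; cases "e = e2") simp_all
qed

lemma euler_prod_nth: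
  assumes "i \<le> n"
  shows "fps_nth (\<Prod>j\<in>{0<..n}. 1 + fps_X ^ j) i = fps_nth (quad_series 1 1) i"
proof -
  have "fps_nth (shanks_sum n) i = (\<Sum>k\<le>n. fps_nth (tail_prod k n * fps_X ^ (k * n + tri k)) i)"
    by (simp add: shanks_sum_def fps_sum_nth)
  also have "\<dots> = (\<Sum>k\<in>{0}. fps_nth (tail_prod k n * fps_X ^ (k * n + tri k)) i)"
  proof (rule sum.mono_neutral_right)
    show "\<forall>k\<in>{..n} - {0}. fps_nth (tail_prod k n * fps_X ^ (k * n + tri k)) i = 0"
    proof
      fix k assume k: "k \<in> {..n} - {0}"
      then obtain l where l: "k = Suc l" by (cases k) auto
      have "i < k * n + tri k" using assms unfolding l by (simp add: tri_Suc)
      then show "fps_nth (tail_prod k n * fps_X ^ (k * n + tri k)) i = 0"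
        by (simp add: fps_X_power_mult_right_nth)
    qed
  qed auto
  also have "\<dots> = fps_nth (\<Prod>j\<in>{0<..n}. 1 + fps_X ^ j) i" by (simp add: tail_prod_def)
  finally have "fps_nth (\<Prod>j\<in>{0<..n}. 1 + fps_X ^ j) i = (of_bool (\<exists>x\<le>6 * n + 1. 24 * i + 1 = x\<^sup>2) :: bit)"
    unfolding shanks_sum_nth by (rule sym)
  moreover have "x \<le> 6 * n + 1" if "24 * i + 1 = x\<^sup>2" for x
  proof (rule power2_le_imp_le)
    have "n \<le> n * n" by simp
    moreover have "(6 * n + 1)\<^sup>2 = 36 * (n * n) + 12 * n + 1"
      by (simp add: power2_eq_square algebra_simps)
    ultimately show "x\<^sup>2 \<le> (6 * n + 1)\<^sup>2" using assms unfolding that[symmetric] by linarith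
  qed simp
  ultimately show ?thesis by (auto simp: quad_series_def)
qed

lemma fps_mult_nth_cong:
  assumes "\<And>i. i \<le> n \<Longrightarrow> fps_nth F i = fps_nth F' i" "\<And>i. i \<le> n \<Longrightarrow> fps_nth G i = fps_nth G' i"
  shows "fps_nth (F * G) n = fps_nth (F' * G') n"
  using assms by (auto simp: fps_mult_nth intro!: sum.cong)

text \<open>Up to degree n only parts at most n matter, so finite products suffice. The Euler
  factors with j not divisible by t cancel the partition series, and the others form the Euler
  product in q^t.\<close>

lemma b_reg_fps_mult:
  assumes "0 < t"
  shows "Abs_fps (\<lambda>n. of_nat (b_reg t n)) * quad_series 1 1 = quad_series 1 1 oo fps_X ^ t"
proof (rule fps_ext)
  fix n
  define S where "S = {j \<in> {0<..n}. \<not> t dvd j}"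
  define T where "T = {j \<in> {0<..n}. t dvd j}"
  have "{p \<in> partitions_of i. \<forall>m\<in>#p. \<not> t dvd m} = {p. set_mset p \<subseteq> S \<and> sum_mset p = i}"
    if "i \<le> n" for i
  proof -
    have "0 < x \<and> x \<le> n" if "x \<in># p" "0 \<notin># p" "sum_mset p = i" for x p
      using that member_le_sum_mset[of x p] \<open>i \<le> n\<close> by (cases "x = 0") auto
    then show ?thesis unfolding partitions_of_def S_def by (auto simp: subset_iff)
  qed
  then have "fps_nth (Abs_fps (\<lambda>n. of_nat (b_reg t n)) * quad_series 1 1) n
      = fps_nth (partition_fps S * (\<Prod>j\<in>{0<..n}. 1 + fps_X ^ j)) n"
    by (intro fps_mult_nth_cong) (simp_all add: euler_prod_nth partition_fps_def b_reg_def)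
  also have "(\<Prod>j\<in>{0<..n}. 1 + fps_X ^ j) = (\<Prod>j\<in>S. 1 + fps_X ^ j) * (\<Prod>j\<in>T. 1 + fps_X ^ j :: bit fps)"
  proof -
    have "{0<..n} = S \<union> T" "S \<inter> T = {}" "finite S" "finite T" by (auto simp: S_def T_def)
    then show ?thesis by (simp add: prod.union_disjoint)
  qed
  also have "partition_fps S * \<dots> = (\<Prod>j\<in>T. 1 + fps_X ^ j)"
    using partition_fps_mult_prod[of S] by (simp add: S_def mult.assoc[symmetric])
  also have "\<dots> = (\<Prod>j\<in>{0<..n div t}. 1 + fps_X ^ j) oo fps_X ^ t"
  proof -
    have "T = (\<lambda>i. t * i) ` {0<..n div t}"
      using assms by (auto simp: T_def less_eq_div_iff_mult_less_eq mult.commute elim!: dvdE)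
    then have "(\<Prod>j\<in>T. 1 + fps_X ^ j :: bit fps) = (\<Prod>i\<in>{0<..n div t}. 1 + fps_X ^ (t * i))"
      using assms by (simp add: prod.reindex inj_on_def)
    also have "\<dots> = (\<Prod>j\<in>{0<..n div t}. 1 + fps_X ^ j) oo fps_X ^ t"
      using assms by (simp add: fps_compose_prod_distrib fps_compose_add_distrib fps_X_power_compose
          power_mult)
    finally show ?thesis .
  qed
  finally show "fps_nth (Abs_fps (\<lambda>n. of_nat (b_reg t n)) * quad_series 1 1) n
      = fps_nth (quad_series 1 1 oo fps_X ^ t) n"
    by (simp add: fps_nth_compose_X_power euler_prod_nth)
qed

section \<open>The generating function of the even-indexed values\<close>

text \<open>Since F * F is F(q^2), it commutes with taking even-indexed coefficients and comes out
  as F.\<close>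

lemma fps_bit_square_mult_nth:
  fixes F G :: "bit fps"
  shows "fps_nth ((F * F) * G) (2 * n) = fps_nth (F * Abs_fps (\<lambda>k. fps_nth G (2 * k))) n"
proof -
  have "fps_nth ((F * F) * G) (2 * n)
      = (\<Sum>i=0..2 * n. fps_nth (F * F) i * fps_nth G (2 * n - i))"
    by (rule fps_mult_nth)
  also have "\<dots> = (\<Sum>i\<in>(\<lambda>i. 2 * i) ` {0..n}. fps_nth (F * F) i * fps_nth G (2 * n - i))"
  proof (rule sum.mono_neutral_right)
    show "\<forall>i\<in>{0..2 * n} - (\<lambda>i. 2 * i) ` {0..n}. fps_nth (F * F) i * fps_nth G (2 * n - i) = 0"
    proof
      fix i assume i: "i \<in> {0..2 * n} - (\<lambda>i. 2 * i) ` {0..n}"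
      have "odd i"
      proof
        assume "even i"
        then obtain j where "i = 2 * j" by (elim evenE)
        then show False using i by auto
      qed
      then show "fps_nth (F * F) i * fps_nth G (2 * n - i) = 0" by (simp add: fps_bit_square_nth)
    qed
  qed auto
  also have "\<dots> = (\<Sum>i=0..n. fps_nth F i * fps_nth G (2 * (n - i)))"
    by (simp add: sum.reindex inj_on_def fps_bit_square_nth diff_mult_distrib2)
  finally show ?thesis by (simp add: fps_mult_nth)
qed

text \<open>An exponent determines its natural root because k and k' are positive, so counting pairs
  of roots is the same as counting pairs of exponents.\<close>

lemma quad_series_mult_nth:
  assumes "0 < k" "0 < k'"
  shows "fps_nth (quad_series r k * quad_series r' k') n
    = of_nat (card {(x, y). \<exists>i j. i + j = n \<and> 24 * i + r = k * x\<^sup>2 \<and> 24 * j + r' = k' * y\<^sup>2})"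
proof -
  define P where "P i \<longleftrightarrow> (\<exists>x::nat. 24 * i + r = k * x\<^sup>2)" for i
  define P' where "P' j \<longleftrightarrow> (\<exists>y::nat. 24 * j + r' = k' * y\<^sup>2)" for j
  define R where "R = {(x, y). \<exists>i j. i + j = n \<and> 24 * i + r = k * x\<^sup>2 \<and> 24 * j + r' = k' * y\<^sup>2}"
  define f where "f = (\<lambda>(x::nat, y::nat). (k * x\<^sup>2 - r) div 24)"
  have f: "f (x, y) = i" if "24 * i + r = k * x\<^sup>2" for x y i
    unfolding f_def by (simp add: that[symmetric])
  have cancel: "x = y" if "c * x\<^sup>2 = c * y\<^sup>2" "0 < c" for c x y :: nat
    using that by simp
  have "bij_betw f R {i \<in> {0..n}. P i \<and> P' (n - i)}"
  proof (rule bij_betw_imageI)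
    show "inj_on f R"
    proof (rule inj_onI)
      fix z w assume "z \<in> R" "w \<in> R" and eq: "f z = f w"
      then obtain x y i j u v i' j' where z: "z = (x, y)" "i + j = n" "24 * i + r = k * x\<^sup>2" "24 * j + r' = k' * y\<^sup>2"
        and w: "w = (u, v)" "i' + j' = n" "24 * i' + r = k * u\<^sup>2" "24 * j' + r' = k' * v\<^sup>2"
        unfolding R_def by auto
      have "i = i'" using eq f[OF z(3), of y] f[OF w(3), of v] z(1) w(1) by simp
      then have "j = j'" using z(2) w(2) by simp
      have "k * x\<^sup>2 = k * u\<^sup>2" unfolding z(3)[symmetric] w(3)[symmetric] \<open>i = i'\<close> ..
      moreover have "k' * y\<^sup>2 = k' * v\<^sup>2" unfolding z(4)[symmetric] w(4)[symmetric] \<open>j = j'\<close> ..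
      ultimately show "z = w" using assms cancel z(1) w(1) by blast
    qed
    show "f ` R = {i \<in> {0..n}. P i \<and> P' (n - i)}"
    proof (intro equalityI subsetI)
      fix i assume "i \<in> f ` R"
      then obtain x y i' j where "i = f (x, y)" and *: "i' + j = n" "24 * i' + r = k * x\<^sup>2"
        "24 * j + r' = k' * y\<^sup>2"
        unfolding R_def by auto
      then have "i = i'" using f by simp
      moreover have "n - i' = j" using *(1) by simp
      ultimately show "i \<in> {i \<in> {0..n}. P i \<and> P' (n - i)}"
        using * unfolding P_def P'_def by auto
    next
      fix i assume "i \<in> {i \<in> {0..n}. P i \<and> P' (n - i)}"
      then obtain x y where *: "i \<le> n" "24 * i + r = k * x\<^sup>2" "24 * (n - i) + r' = k' * y\<^sup>2"
        unfolding P_def P'_def by auto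
      then have "(x, y) \<in> R" unfolding R_def mem_Collect_eq case_prod_conv
        by (intro exI[of _ i] exI[of _ "n - i"] conjI) simp_all
      then show "i \<in> f ` R" using f[OF *(2), of y] by force
    qed
  qed
  then have "card R = card {i \<in> {0..n}. P i \<and> P' (n - i)}" by (rule bij_betw_same_card)
  moreover have "fps_nth (quad_series r k * quad_series r' k') n
      = (\<Sum>i=0..n. of_bool (P i \<and> P' (n - i)))"
    unfolding fps_mult_nth quad_series_def P_def P'_def fps_nth_Abs_fps
    by (rule sum.cong) (simp_all only: of_bool_conj)
  moreover have "(\<Sum>i=0..n. of_bool (P i \<and> P' (n - i)) :: bit) = of_nat (card {i \<in> {0..n}. P i \<and> P' (n - i)})"
    by (subst sum_of_bool_eq) (simp_all only: finite_atLeastAtMost Int_def mem_Collect_eq)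
  ultimately show ?thesis by (simp only: R_def)
qed

section \<open>Coefficients of theta products as solution counts\<close>

lemma square_mod_8_nat: "(x::nat)\<^sup>2 mod 8 \<in> {0, 1, 4}"
proof -
  have "x mod 8 = 0 \<or> x mod 8 = 1 \<or> x mod 8 = 2 \<or> x mod 8 = 3 \<or> x mod 8 = 4 \<or> x mod 8 = 5
      \<or> x mod 8 = 6 \<or> x mod 8 = 7" by presburger
  then have "(x mod 8)\<^sup>2 mod 8 \<in> {0, 1, 4}" by (elim disjE) simp_all
  then show ?thesis by (simp add: power_mod)
qed

lemma square_mod_3_nat: "(x::nat)\<^sup>2 mod 3 = (if 3 dvd x then 0 else 1)"
proof -
  have "x mod 3 = 0 \<or> x mod 3 = 1 \<or> x mod 3 = 2" by presburger
  then have "(x mod 3)\<^sup>2 mod 3 = (if 3 dvd x then 0 else 1)" by (elim disjE) (simp_all add: dvd_eq_mod_eq_0)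
  then show ?thesis by (simp add: power_mod)
qed

lemma odd_square_mod_8_nat:
  assumes "odd (x::nat)"
  shows "x\<^sup>2 mod 8 = 1"
proof -
  have "odd (x\<^sup>2)" using assms by simp
  then show ?thesis using square_mod_8_nat[of x] by (elim insertE emptyE) presburger+
qed

lemma sum_squares_mod_8:
  assumes "((x::nat)\<^sup>2 + y\<^sup>2) mod 8 = 2"
  shows "x\<^sup>2 mod 8 = 1" "y\<^sup>2 mod 8 = 1"
proof -
  have "(x\<^sup>2 mod 8 + y\<^sup>2 mod 8) mod 8 = 2" using assms by (simp add: mod_add_eq)
  then have "x\<^sup>2 mod 8 = 1 \<and> y\<^sup>2 mod 8 = 1"
    using square_mod_8_nat[of x] square_mod_8_nat[of y] by (elim insertE emptyE) simp_all
  then show "x\<^sup>2 mod 8 = 1" "y\<^sup>2 mod 8 = 1" by simp_all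
qed

lemma sum_squares_mod_3:
  assumes "((x::nat)\<^sup>2 + y\<^sup>2) mod 3 = 2"
  shows "x\<^sup>2 mod 3 = 1" "y\<^sup>2 mod 3 = 1"
proof -
  have "(x\<^sup>2 mod 3 + y\<^sup>2 mod 3) mod 3 = 2" using assms by (simp add: mod_add_eq)
  then have "x\<^sup>2 mod 3 = 1 \<and> y\<^sup>2 mod 3 = 1"
    unfolding square_mod_3_nat by (simp split: if_splits)
  then show "x\<^sup>2 mod 3 = 1" "y\<^sup>2 mod 3 = 1" by simp_all
qed

lemma mod_eq_of_add_mult:
  fixes a b c :: nat
  assumes "a + c * u = b + c * v"
  shows "a mod c = b mod c"
  using arg_cong[OF assms, of "\<lambda>t. t mod c"] by simp

lemma eq_24_mult_add_1:
  fixes s :: nat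
  assumes "s mod 8 = 1" "s mod 3 = 1"
  obtains i where "s = 24 * i + 1"
proof -
  have "\<exists>i. s = 24 * i + 1" using assms by presburger
  then show thesis using that by blast
qed

text \<open>The equation alone forces the conditions modulo 24: x and y are odd by reduction modulo
  8, and x is prime to 3.\<close>

lemma quad_set_2M:
  fixes k n :: nat
  assumes "k = 9 \<or> k = 57"
  shows "{(x, y). \<exists>i j. i + j = n \<and> 24 * i + 1 = 1 * x\<^sup>2 \<and> 24 * j + 9 = k * y\<^sup>2}
    = {(x, y). x\<^sup>2 + k * y\<^sup>2 = 2 * (12 * n + 5)}"
proof (intro equalityI subsetI)
  fix z assume "z \<in> {(x, y). x\<^sup>2 + k * y\<^sup>2 = 2 * (12 * n + 5)}"
  then obtain x y where z: "z = (x, y)" and e: "x\<^sup>2 + k * y\<^sup>2 = 24 * n + 10" by auto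
  define s t where "s = x\<^sup>2" and "t = y\<^sup>2"
  have st: "s + k * t = 24 * n + 10" using e by (simp add: s_def t_def)
  \<comment> \<open>Both 9 and 57 are 1 modulo 8.\<close>
  have "(s + t) mod 8 = (2::nat) mod 8"
    using assms
  proof
    assume "k = 9"
    then show ?thesis using st by (intro mod_eq_of_add_mult[of _ _ t _ "3 * n + 1"]) simp
  next
    assume "k = 57"
    then show ?thesis using st by (intro mod_eq_of_add_mult[of _ _ "7 * t" _ "3 * n + 1"]) simp
  qed
  then have s8: "s mod 8 = 1" and t8: "t mod 8 = 1"
    using sum_squares_mod_8[of x y] by (simp_all add: s_def t_def)
  have "s mod 3 = 1 mod 3"
    using assms
  proof
    assume "k = 9"
    then show ?thesis using st by (intro mod_eq_of_add_mult[of _ _ "3 * t" _ "8 * n + 3"]) simp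
  next
    assume "k = 57"
    then show ?thesis using st by (intro mod_eq_of_add_mult[of _ _ "19 * t" _ "8 * n + 3"]) simp
  qed
  then have "s mod 3 = 1" by simp
  then obtain i where i: "s = 24 * i + 1" using eq_24_mult_add_1 s8 by blast
  obtain t' where t': "t = 8 * t' + 1" using t8 by (metis mult_div_mod_eq)
  \<comment> \<open>9 (8 t' + 1) = 24 (3 t') + 9 and 57 (8 t' + 1) = 24 (19 t' + 2) + 9.\<close>
  obtain j where j: "24 * j + 9 = k * t"
    using assms
  proof
    assume "k = 9"
    then show thesis using t' that[of "3 * t'"] by simp
  next
    assume "k = 57"
    then show thesis using t' that[of "19 * t' + 2"] by simp
  qed
  have "i + j = n" using st i j by linarith
  then show "z \<in> {(x, y). \<exists>i j. i + j = n \<and> 24 * i + 1 = 1 * x\<^sup>2 \<and> 24 * j + 9 = k * y\<^sup>2}"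
    using z i j by (auto simp: s_def t_def)
qed auto

text \<open>Here the equation also admits even y, so oddness stays as a condition; the even
  solutions are dealt with in \<open>card_reps_4M_split\<close>.\<close>

lemma quad_set_4M:
  fixes n :: nat
  shows "{(x, y). \<exists>i j. i + j = 2 * n \<and> 24 * i + 1 = 1 * x\<^sup>2 \<and> 24 * j + 19 = 19 * y\<^sup>2}
    = {(x, y). x\<^sup>2 + 19 * y\<^sup>2 = 4 * (12 * n + 5) \<and> odd y}"
proof (intro equalityI subsetI)
  fix z :: "nat \<times> nat"
  assume "z \<in> {(x, y). \<exists>i j. i + j = 2 * n \<and> 24 * i + 1 = 1 * x\<^sup>2 \<and> 24 * j + 19 = 19 * y\<^sup>2}"
  then obtain x y i j where z: "z = (x, y)" and e: "i + j = 2 * n" "24 * i + 1 = x\<^sup>2" "24 * j + 19 = 19 * y\<^sup>2"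
    by auto
  have "odd (19 * y\<^sup>2)" unfolding e(3)[symmetric] by simp
  then have "odd y" by simp
  moreover have "x\<^sup>2 + 19 * y\<^sup>2 = 4 * (12 * n + 5)"
    unfolding e(2)[symmetric] e(3)[symmetric] using e(1) by simp
  ultimately show "z \<in> {(x, y). x\<^sup>2 + 19 * y\<^sup>2 = 4 * (12 * n + 5) \<and> odd y}" using z by simp
next
  fix z assume "z \<in> {(x, y). x\<^sup>2 + 19 * y\<^sup>2 = 4 * (12 * n + 5) \<and> odd y}"
  then obtain x y where z: "z = (x, y)" and e: "x\<^sup>2 + 19 * y\<^sup>2 = 48 * n + 20" "odd y" by auto
  define s t where "s = x\<^sup>2" and "t = y\<^sup>2"
  have st: "s + 19 * t = 48 * n + 20" using e by (simp add: s_def t_def)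
  have t8: "t mod 8 = 1" unfolding t_def using e(2) by (rule odd_square_mod_8_nat)
  obtain t' where t': "t = 8 * t' + 1" using t8 by (metis mult_div_mod_eq)
  have "s mod 8 = 1 mod 8"
    using st t' by (intro mod_eq_of_add_mult[of _ _ "19 * t'" _ "6 * n"]) simp
  then have s8: "s mod 8 = 1" by simp
  have "(s + t) mod 3 = 2 mod 3"
    using st by (intro mod_eq_of_add_mult[of _ _ "6 * t" _ "16 * n + 6"]) simp
  then have "s mod 3 = 1" "t mod 3 = 1" using sum_squares_mod_3[of x y] by (simp_all add: s_def t_def)
  then obtain i j where i: "s = 24 * i + 1" and j: "t = 24 * j + 1" using eq_24_mult_add_1 s8 t8 by metis
  have "i + 19 * j = 2 * n" using st unfolding i j by simp
  then show "z \<in> {(x, y). \<exists>i j. i + j = 2 * n \<and> 24 * i + 1 = 1 * x\<^sup>2 \<and> 24 * j + 19 = 19 * y\<^sup>2}"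
    using z i j by (auto simp: s_def t_def intro!: exI[of _ i] exI[of _ "19 * j"])
qed

text \<open>This is the coefficient of f_2 times q^6 W(q^19). The exponents of f_2 are even, hence
  the witness \<open>2 * i\<close>; and y^2 = 3 j + 1 gives 152 y^2 = 24 (19 j + 6) + 8.\<close>

lemma quad_set_M:
  fixes n :: nat
  shows "{(x, y). \<exists>i j. i + j = n \<and> 24 * i + 2 = 2 * x\<^sup>2 \<and> 24 * j + 8 = 152 * y\<^sup>2}
    = {(x, y). x\<^sup>2 + 76 * y\<^sup>2 = 12 * n + 5}"
proof (intro equalityI subsetI)
  fix z assume "z \<in> {(x, y). x\<^sup>2 + 76 * y\<^sup>2 = 12 * n + 5}"
  then obtain x y where z: "z = (x, y)" and e: "x\<^sup>2 + 76 * y\<^sup>2 = 12 * n + 5" by auto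
  define s t where "s = x\<^sup>2" and "t = y\<^sup>2"
  have st: "s + 76 * t = 12 * n + 5" using e by (simp add: s_def t_def)
  have "(s + t) mod 3 = 2 mod 3"
    using st by (intro mod_eq_of_add_mult[of _ _ "25 * t" _ "4 * n + 1"]) simp
  then have s3: "s mod 3 = 1" and t3: "t mod 3 = 1"
    using sum_squares_mod_3[of x y] by (simp_all add: s_def t_def)
  have "s mod 2 = 1 mod 2"
    using st by (intro mod_eq_of_add_mult[of _ _ "38 * t" _ "6 * n + 2"]) simp
  then have "odd s" by presburger
  then have "s mod 8 = 1" unfolding s_def by (intro odd_square_mod_8_nat) simp
  then obtain i where i: "s = 24 * i + 1" using eq_24_mult_add_1 s3 by blast
  obtain j where j: "t = 3 * j + 1" using t3 by (metis mult_div_mod_eq)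
  have "2 * i + (19 * j + 6) = n" using st unfolding i j by simp
  then show "z \<in> {(x, y). \<exists>i j. i + j = n \<and> 24 * i + 2 = 2 * x\<^sup>2 \<and> 24 * j + 8 = 152 * y\<^sup>2}"
    using z i j by (auto simp: s_def t_def intro!: exI[of _ "2 * i"] exI[of _ "19 * j + 6"])
qed auto

text \<open>If y = 2 w then x = 2 u and u^2 + 19 w^2 = M. An odd w would give u^2 = 2 (mod 4), so y
  is a multiple of 4 and the even solutions are those of u^2 + 76 v^2 = M.\<close>

lemma card_reps_4M_split:
  assumes "M mod 12 = (5::nat)"
  shows "card {(x, y). x\<^sup>2 + 19 * y\<^sup>2 = 4 * M}
    = card {(x, y). x\<^sup>2 + 19 * y\<^sup>2 = 4 * M \<and> odd y} + card {(x, y). x\<^sup>2 + 76 * y\<^sup>2 = M}"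
proof -
  define S where "S = {(x::nat, y::nat). x\<^sup>2 + 19 * y\<^sup>2 = 4 * M}"
  define A where "A = {(x::nat, y::nat). x\<^sup>2 + 19 * y\<^sup>2 = 4 * M \<and> odd y}"
  define B where "B = {(x::nat, y::nat). x\<^sup>2 + 76 * y\<^sup>2 = M}"
  define f :: "nat \<times> nat \<Rightarrow> nat \<times> nat" where "f = (\<lambda>(x, y). (2 * x, 4 * y))"
  have "finite S"
  proof (rule finite_subset)
    show "S \<subseteq> {..4 * M} \<times> {..4 * M}"
    proof clarify
      fix x y assume "(x, y) \<in> S"
      then have e: "x\<^sup>2 + 19 * y\<^sup>2 = 4 * M" by (simp add: S_def)
      have "x \<le> x\<^sup>2" "y \<le> y\<^sup>2" by (simp_all add: power2_eq_square)
      then show "x \<in> {..4 * M} \<and> y \<in> {..4 * M}" using e by auto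
    qed
  qed simp
  have M4: "M mod 4 = 1" using assms by presburger
  have "S = A \<union> f ` B"
  proof (intro equalityI subsetI)
    fix z assume "z \<in> S"
    then obtain x y where z: "z = (x, y)" and e: "x\<^sup>2 + 19 * y\<^sup>2 = 4 * M" by (auto simp: S_def)
    show "z \<in> A \<union> f ` B"
    proof (cases "odd y")
      case True
      then show ?thesis using z e by (simp add: A_def)
    next
      case False
      then obtain w where w: "y = 2 * w" by (auto elim: evenE)
      have "x\<^sup>2 = 2 * (2 * M - 38 * w\<^sup>2)" using e unfolding w by (simp add: power2_eq_square)
      then have "even (x\<^sup>2)" by (metis dvd_triv_left)
      then obtain u where u: "x = 2 * u" by (auto elim: evenE)
      have e': "u\<^sup>2 + 19 * w\<^sup>2 = M" using e unfolding u w by (simp add: power2_eq_square)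
      have "even w"
      proof (rule ccontr)
        assume "odd w"
        then have "w\<^sup>2 mod 8 = 1" by (rule odd_square_mod_8_nat)
        then obtain w' where w': "w\<^sup>2 = 8 * w' + 1" by (metis mult_div_mod_eq)
        obtain m where "M = 4 * m + 1" using M4 by (metis mult_div_mod_eq)
        then have "u\<^sup>2 + 4 * (38 * w' + 5) = 2 + 4 * m" using e' unfolding w' by simp
        then have "u\<^sup>2 mod 4 = 2 mod 4" by (rule mod_eq_of_add_mult)
        then have "u\<^sup>2 mod 4 = 2" by simp
        then show False using square_mod_8_nat[of u] by (elim insertE emptyE) presburger+
      qed
      then obtain v where v: "w = 2 * v" by (auto elim: evenE)
      have "(u, v) \<in> B" using e' unfolding v B_def by (simp add: power2_eq_square)
      moreover have "z = f (u, v)" using z u w v by (simp add: f_def)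
      ultimately show ?thesis by blast
    qed
  next
    fix z assume "z \<in> A \<union> f ` B"
    then show "z \<in> S" by (auto simp: A_def B_def S_def f_def power_mult_distrib)
  qed
  moreover have "A \<inter> f ` B = {}" by (auto simp: A_def f_def)
  ultimately have "card S = card A + card (f ` B)"
    using \<open>finite S\<close> by (metis card_Un_disjoint finite_Un)
  moreover have "card (f ` B) = card B" by (rule card_image) (auto simp: f_def inj_on_def)
  ultimately show ?thesis by (simp add: S_def A_def B_def)
qed

lemma quad_series_1_1_square: "quad_series 1 1 * quad_series 1 1 = quad_series 2 2"
proof (rule fps_ext)
  fix n
  have "(\<exists>x. 24 * n + 2 = 2 * x\<^sup>2) \<longleftrightarrow> even n \<and> (\<exists>x. 24 * (n div 2) + 1 = (x::nat)\<^sup>2)"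
  proof
    assume "\<exists>x. 24 * n + 2 = 2 * x\<^sup>2"
    then obtain x where "24 * n + 2 = 2 * x\<^sup>2" by (elim exE)
    then have x: "x\<^sup>2 = 12 * n + 1" by simp
    then have "odd (x\<^sup>2)" by simp
    then have "x\<^sup>2 mod 8 = 1" by (intro odd_square_mod_8_nat) simp
    then have "even n" using x by presburger
    moreover have "24 * (n div 2) + 1 = x\<^sup>2" using x \<open>even n\<close> by presburger
    ultimately show "even n \<and> (\<exists>x. 24 * (n div 2) + 1 = x\<^sup>2)" by blast
  next
    assume "even n \<and> (\<exists>x. 24 * (n div 2) + 1 = x\<^sup>2)"
    then obtain x where "even n" "24 * (n div 2) + 1 = x\<^sup>2" by (elim conjE exE)
    then have "24 * n + 2 = 2 * x\<^sup>2" by presburger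
    then show "\<exists>x. 24 * n + 2 = 2 * x\<^sup>2" ..
  qed
  then show "fps_nth (quad_series 1 1 * quad_series 1 1) n = fps_nth (quad_series 2 2) n"
    unfolding fps_bit_square_nth by (simp add: quad_series_def)
qed

lemma quad_series_1_1_compose: "quad_series 1 1 oo fps_X ^ 19 = quad_series 19 19"
proof (rule fps_ext)
  fix n
  have "(\<exists>x. 24 * n + 19 = 19 * x\<^sup>2) \<longleftrightarrow> 19 dvd n \<and> (\<exists>x. 24 * (n div 19) + 1 = (x::nat)\<^sup>2)"
  proof
    assume "\<exists>x. 24 * n + 19 = 19 * x\<^sup>2"
    then obtain x where x: "24 * n + 19 = 19 * x\<^sup>2" by (elim exE)
    then have "19 dvd 24 * n" by (metis dvd_add_left_iff dvd_refl dvd_triv_left)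
    then have "19 dvd n" by presburger
    moreover from this obtain m where "n = 19 * m" by (elim dvdE)
    then have "24 * (n div 19) + 1 = x\<^sup>2" using x by simp
    ultimately show "19 dvd n \<and> (\<exists>x. 24 * (n div 19) + 1 = x\<^sup>2)" by blast
  next
    assume "19 dvd n \<and> (\<exists>x. 24 * (n div 19) + 1 = x\<^sup>2)"
    then obtain x where x: "19 dvd n" "24 * (n div 19) + 1 = x\<^sup>2" by (elim conjE exE)
    obtain m where "n = 19 * m" using x(1) by (elim dvdE)
    then have "24 * n + 19 = 19 * x\<^sup>2" unfolding x(2)[symmetric] by simp
    then show "\<exists>x. 24 * n + 19 = 19 * x\<^sup>2" ..
  qed
  then show "fps_nth (quad_series 1 1 oo fps_X ^ 19) n = fps_nth (quad_series 19 19) n"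
    unfolding fps_nth_compose_X_power by (simp add: quad_series_def)
qed

definition b19_theta :: "bit fps"
  where "b19_theta = quad_series 9 9 + quad_series 1 1 * quad_series 8 152 + quad_series 9 57"

text \<open>The right side counts the solutions of x^2 + 19 y^2 = 4 M with odd y. The middle term of
  the bracket, through f_1^2 = f_2, contributes those with even y, so that
  \<open>even_sum_reps\<close> applies to the complete count.\<close>

lemma even_part_quad_series:
  "quad_series 1 1 * b19_theta = Abs_fps (\<lambda>n. fps_nth (quad_series 1 1 * quad_series 19 19) (2 * n))"
proof (rule fps_ext)
  fix n :: nat
  define M where "M = 12 * n + 5"
  have M: "M mod 12 = 5" unfolding M_def by presburger
  let ?A = "card {(x, y). x\<^sup>2 + 19 * y\<^sup>2 = 4 * M \<and> odd y}"
  let ?B = "card {(x, y). x\<^sup>2 + 76 * y\<^sup>2 = M}"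
  let ?C = "card {(x, y). x\<^sup>2 + 9 * y\<^sup>2 = 2 * M}"
  let ?D = "card {(x, y). x\<^sup>2 + 57 * y\<^sup>2 = 2 * M}"
  have "quad_series 1 1 * b19_theta = quad_series 1 1 * quad_series 9 9
      + quad_series 2 2 * quad_series 8 152 + quad_series 1 1 * quad_series 9 57"
    by (simp add: b19_theta_def distrib_left quad_series_1_1_square[symmetric] mult.assoc)
  then have "fps_nth (quad_series 1 1 * b19_theta) n = of_nat ?C + of_nat ?B + of_nat ?D"
    using quad_set_2M[of 9 n] quad_set_2M[of 57 n] quad_set_M[of n]
    by (simp add: quad_series_mult_nth M_def del: mult_1)
  also have "\<dots> = of_nat (?C + ?B + ?D)" by simp
  also have "\<dots> = of_nat ?A"
  proof -
    have "?C + ?B + ?D + ?A = card {(x, y). x\<^sup>2 + 19 * y\<^sup>2 = 4 * M} + ?C + ?D"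
      unfolding card_reps_4M_split[OF M] by simp
    then show ?thesis unfolding of_nat_bit_eq_iff using even_sum_reps[OF M] by (simp only:)
  qed
  also have "\<dots> = fps_nth (quad_series 1 1 * quad_series 19 19) (2 * n)"
    using quad_set_4M[of n] by (simp add: quad_series_mult_nth M_def del: mult_1)
  finally show "fps_nth (quad_series 1 1 * b19_theta) n
      = fps_nth (Abs_fps (\<lambda>n. fps_nth (quad_series 1 1 * quad_series 19 19) (2 * n))) n" by simp
qed

text \<open>Multiplying R f_1 = f_19 by f_1 puts the square f_1^2 in front of R, so the even part of
  R appears with a factor f_1, which cancels because its constant term is 1.\<close>

lemma b_reg_19_even_fps: "Abs_fps (\<lambda>n. of_nat (b_reg 19 (2 * n))) = b19_theta"
proof -
  define R :: "bit fps" where "R = Abs_fps (\<lambda>n. of_nat (b_reg 19 n))"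
  let ?Q = "quad_series 1 1"
  have "R * ?Q = quad_series 19 19"
    unfolding R_def using b_reg_fps_mult[of 19] quad_series_1_1_compose by simp
  then have "(?Q * ?Q) * R = ?Q * quad_series 19 19" by (metis mult.assoc mult.commute)
  then have "Abs_fps (\<lambda>n. fps_nth (?Q * quad_series 19 19) (2 * n))
      = Abs_fps (\<lambda>n. fps_nth ((?Q * ?Q) * R) (2 * n))" by (simp only:)
  also have "\<dots> = ?Q * Abs_fps (\<lambda>k. fps_nth R (2 * k))"
    by (rule fps_ext) (simp only: fps_bit_square_mult_nth fps_nth_Abs_fps)
  finally have "?Q * b19_theta = ?Q * Abs_fps (\<lambda>n. of_nat (b_reg 19 (2 * n)))"
    unfolding even_part_quad_series by (simp add: R_def)
  moreover have "fps_nth ?Q 0 = 1" by (auto simp: quad_series_def intro: exI[of _ 1])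
  then have "?Q \<noteq> 0" by auto
  ultimately show ?thesis by simp
qed

section \<open>Self-similarity at the prime 11\<close>

text \<open>Modulo 11 the form is x^2 + (3 y)^2, as 152 = 9 + 13 * 11, and -1 is not a
  square.\<close>

lemma eleven_dvd_quad_form:
  assumes "11 dvd x\<^sup>2 + 152 * (y::nat)\<^sup>2"
  shows "11 dvd x" "11 dvd y"
proof -
  have sq: "z\<^sup>2 mod 11 \<in> {0, 1, 3, 4, 5, 9} \<and> (z\<^sup>2 mod 11 = 0 \<longrightarrow> 11 dvd z)" for z :: nat
  proof -
    have "z mod 11 = 0 \<or> z mod 11 = 1 \<or> z mod 11 = 2 \<or> z mod 11 = 3 \<or> z mod 11 = 4 \<or> z mod 11 = 5
        \<or> z mod 11 = 6 \<or> z mod 11 = 7 \<or> z mod 11 = 8 \<or> z mod 11 = 9 \<or> z mod 11 = 10" by presburger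
    then have "(z mod 11)\<^sup>2 mod 11 \<in> {0, 1, 3, 4, 5, 9} \<and> ((z mod 11)\<^sup>2 mod 11 = 0 \<longrightarrow> z mod 11 = 0)"
      by (elim disjE) simp_all
    then show ?thesis by (simp add: power_mod dvd_eq_mod_eq_0)
  qed
  have "[x\<^sup>2 mod 11 + 9 * (y\<^sup>2 mod 11) = x\<^sup>2 + 9 * y\<^sup>2] (mod 11)"
    by (intro cong_add cong_mult cong_refl) (simp_all add: cong_def)
  then have "(x\<^sup>2 mod 11 + 9 * (y\<^sup>2 mod 11)) mod 11 = (x\<^sup>2 + 9 * y\<^sup>2) mod 11"
    by (simp only: cong_def)
  also have "\<dots> = (x\<^sup>2 + 152 * y\<^sup>2) mod 11"
    by (rule mod_eq_of_add_mult[of _ _ "13 * y\<^sup>2" _ 0]) simp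
  also have "\<dots> = 0" using assms by simp
  finally have "x\<^sup>2 mod 11 = 0 \<and> y\<^sup>2 mod 11 = 0"
    using sq[of x] sq[of y] by (elim conjE insertE emptyE) simp_all
  then show "11 dvd x" "11 dvd y" using sq[of x] sq[of y] by simp_all
qed

text \<open>That x is prime to 3 has to be demanded, since it does not follow from the equation; y
  is then prime to 3 by reduction modulo 3.\<close>

lemma b19_theta_nth:
  "fps_nth b19_theta n = of_bool (\<exists>x::nat. 24 * n + 9 = 9 * x\<^sup>2)
    + of_nat (card {(x::nat, y). x\<^sup>2 + 152 * y\<^sup>2 = 24 * n + 9 \<and> \<not> 3 dvd x})
    + of_bool (\<exists>x::nat. 24 * n + 9 = 57 * x\<^sup>2)"
proof -
  have "{(x::nat, y::nat). \<exists>i j. i + j = n \<and> 24 * i + 1 = 1 * x\<^sup>2 \<and> 24 * j + 8 = 152 * y\<^sup>2}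
    = {(x, y). x\<^sup>2 + 152 * y\<^sup>2 = 24 * n + 9 \<and> \<not> 3 dvd x}"
  proof (intro equalityI subsetI)
    fix z :: "nat \<times> nat"
    assume "z \<in> {(x, y). \<exists>i j. i + j = n \<and> 24 * i + 1 = 1 * x\<^sup>2 \<and> 24 * j + 8 = 152 * y\<^sup>2}"
    then obtain x y i j where z: "z = (x, y)" and e: "i + j = n" "24 * i + 1 = x\<^sup>2" "24 * j + 8 = 152 * y\<^sup>2"
      by auto
    have "x\<^sup>2 + 152 * y\<^sup>2 = 24 * n + 9"
      unfolding e(2)[symmetric] e(3)[symmetric] using e(1) by simp
    then show "z \<in> {(x, y). x\<^sup>2 + 152 * y\<^sup>2 = 24 * n + 9 \<and> \<not> 3 dvd x}"
      using z square_eq_24_residue(2)[OF e(2)] by simp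
  next
    fix z assume "z \<in> {(x::nat, y::nat). x\<^sup>2 + 152 * y\<^sup>2 = 24 * n + 9 \<and> \<not> 3 dvd x}"
    then obtain x y where z: "z = (x, y)" and e: "x\<^sup>2 + 152 * y\<^sup>2 = 24 * n + 9" and x: "\<not> 3 dvd x" by auto
    define s t where "s = x\<^sup>2" and "t = y\<^sup>2"
    have st: "s + 152 * t = 24 * n + 9" using e by (simp add: s_def t_def)
    have "s mod 8 = 1 mod 8"
      using st by (intro mod_eq_of_add_mult[of _ _ "19 * t" _ "3 * n + 1"]) simp
    then have s8: "s mod 8 = 1" by simp
    have s3: "s mod 3 = 1" unfolding s_def square_mod_3_nat using x by simp
    obtain i where i: "s = 24 * i + 1" using eq_24_mult_add_1[OF s8 s3] by blast
    have "t mod 3 \<noteq> 0"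
    proof
      assume "t mod 3 = 0"
      then obtain m where m: "t = 3 * m" by (metis mult_div_mod_eq add_0_right)
      have "8 + 24 * n = 0 + 24 * (i + 19 * m)" using st unfolding i m by simp
      then have "8 mod 24 = (0::nat) mod 24" by (rule mod_eq_of_add_mult)
      then show False by simp
    qed
    then have "t mod 3 = 1" unfolding t_def square_mod_3_nat by (simp split: if_splits)
    then obtain j where j: "t = 3 * j + 1" by (metis mult_div_mod_eq)
    have "i + (19 * j + 6) = n" using st unfolding i j by simp
    then show "z \<in> {(x, y). \<exists>i j. i + j = n \<and> 24 * i + 1 = 1 * x\<^sup>2 \<and> 24 * j + 8 = 152 * y\<^sup>2}"
      using z i j by (auto simp: s_def t_def intro!: exI[of _ i] exI[of _ "19 * j + 6"])
  qed
  then show ?thesis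
    unfolding b19_theta_def fps_add_nth quad_series_mult_nth[OF zero_less_one zero_less_numeral]
    by (simp add: quad_series_def del: mult_1)
qed

text \<open>Since 24 * 45 + 9 = 121 * 9, the map m -> 121 m + 45 multiplies 24 m + 9 by 121. All
  variables are then divisible by 11 and can be divided by it, which does not affect divisibility by
  3.\<close>

lemma b19_theta_nth_121: "fps_nth b19_theta (121 * m + 45) = fps_nth b19_theta m"
proof -
  have N: "24 * (121 * m + 45) + 9 = 121 * (24 * m + 9)" by simp
  have scale: "(\<exists>x::nat. 121 * (24 * m + 9) = k * x\<^sup>2) \<longleftrightarrow> (\<exists>x::nat. 24 * m + 9 = k * x\<^sup>2)"
    if k: "\<not> 11 dvd k" for k :: nat
  proof
    assume "\<exists>x::nat. 121 * (24 * m + 9) = k * x\<^sup>2"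
    then obtain x where x: "121 * (24 * m + 9) = k * x\<^sup>2" by (elim exE)
    have p: "prime (11::nat)" by simp
    have "11 dvd 121 * (24 * m + 9)" by (intro dvd_mult2) simp
    then have "11 dvd k * x\<^sup>2" unfolding x .
    then have "11 dvd x" using k p by (metis prime_dvd_multD prime_dvd_power)
    then obtain y where "x = 11 * y" by (elim dvdE)
    then have "24 * m + 9 = k * y\<^sup>2" using x by (simp add: power_mult_distrib)
    then show "\<exists>x::nat. 24 * m + 9 = k * x\<^sup>2" ..
  next
    assume "\<exists>x::nat. 24 * m + 9 = k * x\<^sup>2"
    then obtain x where "24 * m + 9 = k * x\<^sup>2" by (elim exE)
    then have "121 * (24 * m + 9) = k * (11 * x)\<^sup>2" by (simp add: power_mult_distrib)
    then show "\<exists>x::nat. 121 * (24 * m + 9) = k * x\<^sup>2" ..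
  qed
  have "{(x::nat, y::nat). x\<^sup>2 + 152 * y\<^sup>2 = 121 * (24 * m + 9) \<and> \<not> 3 dvd x}
      = (\<lambda>(x, y). (11 * x, 11 * y)) ` {(x, y). x\<^sup>2 + 152 * y\<^sup>2 = 24 * m + 9 \<and> \<not> 3 dvd x}"
  proof (intro equalityI subsetI)
    fix z assume "z \<in> {(x::nat, y::nat). x\<^sup>2 + 152 * y\<^sup>2 = 121 * (24 * m + 9) \<and> \<not> 3 dvd x}"
    then obtain x y where z: "z = (x, y)" and e: "x\<^sup>2 + 152 * y\<^sup>2 = 121 * (24 * m + 9)" and x: "\<not> 3 dvd x" by auto
    have "11 dvd x\<^sup>2 + 152 * y\<^sup>2" unfolding e by (intro dvd_mult2) simp
    then obtain u v where uv: "x = 11 * u" "y = 11 * v" using eleven_dvd_quad_form by (meson dvdE)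
    have "u\<^sup>2 + 152 * v\<^sup>2 = 24 * m + 9" using e unfolding uv by (simp add: power_mult_distrib)
    moreover have "\<not> 3 dvd u" using x uv by auto
    ultimately show "z \<in> (\<lambda>(x, y). (11 * x, 11 * y)) ` {(x, y). x\<^sup>2 + 152 * y\<^sup>2 = 24 * m + 9 \<and> \<not> 3 dvd x}"
      using z uv by force
  next
    fix z assume "z \<in> (\<lambda>(x, y). (11 * x, 11 * y)) ` {(x::nat, y::nat). x\<^sup>2 + 152 * y\<^sup>2 = 24 * m + 9 \<and> \<not> 3 dvd x}"
    then obtain u v where z: "z = (11 * u, 11 * v)" and e: "u\<^sup>2 + 152 * v\<^sup>2 = 24 * m + 9" and u: "\<not> 3 dvd u" by auto
    have "\<not> 3 dvd 11 * u" using u by presburger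
    moreover have "(11 * u)\<^sup>2 + 152 * (11 * v)\<^sup>2 = 121 * (u\<^sup>2 + 152 * v\<^sup>2)" by (simp add: power_mult_distrib)
    ultimately show "z \<in> {(x, y). x\<^sup>2 + 152 * y\<^sup>2 = 121 * (24 * m + 9) \<and> \<not> 3 dvd x}"
      using z e by simp
  qed
  then have card: "card {(x::nat, y::nat). x\<^sup>2 + 152 * y\<^sup>2 = 121 * (24 * m + 9) \<and> \<not> 3 dvd x}
      = card {(x::nat, y::nat). x\<^sup>2 + 152 * y\<^sup>2 = 24 * m + 9 \<and> \<not> 3 dvd x}"
    by (simp add: card_image inj_on_def)
  have "\<not> (11::nat) dvd 9" "\<not> (11::nat) dvd 57" by presburger+
  then show ?thesis by (simp only: b19_theta_nth N card scale[of 9] scale[of 57] simp_thms)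
qed

text \<open>Here 24 n + 9 = 11 (24 j + 3), so a representation of any of the three kinds has
  variables divisible by 11 and requires 121 to divide it, which happens only for j = 4 (mod
  11).\<close>

lemma b19_theta_nth_11:
  assumes "j mod 11 \<noteq> 4"
  shows "fps_nth b19_theta (11 * j + 1) = 0"
proof -
  have N: "24 * (11 * j + 1) + 9 = 11 * (24 * j + 3)" by simp
  have not11: "\<not> 121 dvd 11 * (24 * j + 3)"
  proof
    assume "121 dvd 11 * (24 * j + 3)"
    then obtain c where "11 * (24 * j + 3) = 121 * c" by (elim dvdE)
    \<comment> \<open>Multiplication by 6, the inverse of 24 modulo 11: the left side is 6 (24 j +
      3).\<close>
    then have "j + 7 + 11 * (13 * j + 1) = 0 + 11 * (6 * c)" by simp
    then have "(j + 7) mod 11 = 0 mod 11" by (rule mod_eq_of_add_mult)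
    then show False using assms by presburger
  qed
  have none: "\<not> (\<exists>x::nat. 11 * (24 * j + 3) = k * x\<^sup>2)" if k: "\<not> 11 dvd k" for k :: nat
  proof
    assume "\<exists>x::nat. 11 * (24 * j + 3) = k * x\<^sup>2"
    then obtain x where x: "11 * (24 * j + 3) = k * x\<^sup>2" by (elim exE)
    have p: "prime (11::nat)" by simp
    have "11 dvd k * x\<^sup>2" unfolding x[symmetric] by (rule dvd_triv_left)
    then have "11 dvd x" using k p by (metis prime_dvd_multD prime_dvd_power)
    then obtain y where "x = 11 * y" by (elim dvdE)
    then have "11 * (24 * j + 3) = 121 * (k * y\<^sup>2)" using x by (simp add: power_mult_distrib)
    then show False using not11 by (metis dvd_triv_left)
  qed
  have empty: "{(x::nat, y::nat). x\<^sup>2 + 152 * y\<^sup>2 = 11 * (24 * j + 3) \<and> \<not> 3 dvd x} = {}"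
  proof (intro equals0I)
    fix z assume "z \<in> {(x::nat, y::nat). x\<^sup>2 + 152 * y\<^sup>2 = 11 * (24 * j + 3) \<and> \<not> 3 dvd x}"
    then obtain x y where e: "x\<^sup>2 + 152 * y\<^sup>2 = 11 * (24 * j + 3)" by auto
    have "11 dvd x\<^sup>2 + 152 * y\<^sup>2" unfolding e by (rule dvd_triv_left)
    then obtain u v where uv: "x = 11 * u" "y = 11 * v" using eleven_dvd_quad_form by (meson dvdE)
    have "11 * (24 * j + 3) = 121 * (u\<^sup>2 + 152 * v\<^sup>2)" using e unfolding uv by (simp add: power_mult_distrib)
    then show False using not11 by (metis dvd_triv_left)
  qed
  have "\<not> (11::nat) dvd 9" "\<not> (11::nat) dvd 57" by presburger+
  then show ?thesis
    by (simp only: b19_theta_nth N none[of 9] none[of 57] empty card.empty simp_thms of_bool_eq of_nat_0 add_0)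
qed

section \<open>Parity of the values and iteration\<close>

lemma of_nat_b_reg_19: "of_nat (b_reg 19 (2 * n)) = fps_nth b19_theta n"
  unfolding b_reg_19_even_fps[symmetric] by simp

lemma even_b_reg_19:
  assumes "j mod 11 \<noteq> 4"
  shows "even (b_reg 19 (22 * j + 2))"
proof -
  have "22 * j + 2 = 2 * (11 * j + 1)" by simp
  then have "(of_nat (b_reg 19 (22 * j + 2)) :: bit) = of_nat 0"
    using b19_theta_nth_11[OF assms] by (simp only: of_nat_b_reg_19 of_nat_0)
  then show ?thesis unfolding of_nat_bit_eq_iff by simp
qed

lemma b_reg_19_parity_step: "even (b_reg 19 (242 * m + 90)) \<longleftrightarrow> even (b_reg 19 (2 * m))"
proof -
  have "242 * m + 90 = 2 * (121 * m + 45)" by simp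
  then have "(of_nat (b_reg 19 (242 * m + 90)) :: bit) = of_nat (b_reg 19 (2 * m))"
    by (simp only: of_nat_b_reg_19 b19_theta_nth_121)
  then show ?thesis unfolding of_nat_bit_eq_iff by simp
qed

text \<open>Here d = e + 1. Because 121 = 1 (mod 120), the division by 120 is exact, and the
  quotient r satisfies r(e + 1) = 121 r(e) + 1. This turns the index into iterates of N -> 121 N +
  90, the doubled form of m -> 121 m + 45.\<close>

lemma index_recursion:
  fixes n k e :: nat
  defines "I \<equiv> \<lambda>e. 2 * 11 ^ (2 * Suc e) * n + 2 * 11 ^ (2 * Suc e - 1) * k + 2 * 11 ^ (2 * Suc e - 2)
    + 90 * ((11 ^ (2 * Suc e - 2) - 1) div 120)"
  shows "even (I e)" "I 0 = 22 * (11 * n + k) + 2" "I (Suc e) = 121 * I e + 90"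
proof -
  define r where "r e = ((11::nat) ^ (2 * e) - 1) div 120" for e :: nat
  have r: "(11::nat) ^ (2 * e) = 120 * r e + 1" for e :: nat
  proof -
    have "[(121::nat) ^ e = 1 ^ e] (mod 120)" by (intro cong_pow) (simp add: cong_def)
    then have "(11::nat) ^ (2 * e) mod 120 = 1" by (simp add: power_mult cong_def)
    then show ?thesis unfolding r_def
      by (metis add_diff_cancel_right' mult_div_mod_eq nonzero_mult_div_cancel_left zero_neq_numeral)
  qed
  have I: "I e = 242 * (11 ^ (2 * e) * n) + 22 * (11 ^ (2 * e) * k) + 2 * 11 ^ (2 * e) + 90 * r e" for e
    unfolding I_def r_def by simp
  have rS: "r (Suc e) = 121 * r e + 1" for e
    using r[of "Suc e"] r[of e] by simp
  show "even (I e)" unfolding I by simp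
  show "I 0 = 22 * (11 * n + k) + 2" unfolding I by (simp add: r_def)
  show "I (Suc e) = 121 * I e + 90" unfolding I rS by (simp add: algebra_simps)
qed

theorem theorem1p4:
  shows "fps_cong
           (Abs_fps (\<lambda>n. int (b_reg 19 (22 * n + 2))))
           (fps_X ^ 4 * (Abs_fps (\<lambda>n. int (b_reg 19 (2 * n))) oo fps_X ^ 11))
           2
       \<and> (\<forall>(k::int) (n::nat).
           \<not> [k = 4] (mod 11) \<and> 0 \<le> 242 * int n + 22 * k + 2 \<longrightarrow>
           [b_reg 19 (nat (242 * int n + 22 * k + 2)) = 0] (mod 2))
       \<and> (\<forall>(d::nat) (k::nat) (n::nat).
           1 \<le> d \<and> 1 \<le> k \<and> \<not> [k = 4] (mod 11) \<longrightarrow>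
           [b_reg 19 (2 * 11 ^ (2 * d) * n + 2 * 11 ^ (2 * d - 1) * k + 2 * 11 ^ (2 * d - 2)
                  + 90 * ((11 ^ (2 * d - 2) - 1) div 120)) = 0] (mod 2))"
proof (intro conjI allI impI)
  have cong_parity: "[int a = int b] (mod 2)" if "even a \<longleftrightarrow> even b" for a b :: nat
    using that unfolding cong_def by presburger
  show "fps_cong (Abs_fps (\<lambda>n. int (b_reg 19 (22 * n + 2))))
      (fps_X ^ 4 * (Abs_fps (\<lambda>n. int (b_reg 19 (2 * n))) oo fps_X ^ 11)) 2"
    unfolding fps_cong_def
  proof
    fix i
    let ?F = "fps_X ^ 4 * (Abs_fps (\<lambda>n. int (b_reg 19 (2 * n))) oo fps_X ^ 11)"
    show "[fps_nth (Abs_fps (\<lambda>n. int (b_reg 19 (22 * n + 2)))) i = fps_nth ?F i] (mod 2)"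
    \<comment> \<open>The right side lives on exponents 11 m + 4, where 22 i + 2 = 242 m + 90;
      elsewhere both sides are even.\<close>
    proof (cases "i mod 11 = 4")
      case True
      then obtain m where m: "i = 11 * m + 4" by (metis mult_div_mod_eq)
      have "fps_nth ?F i = int (b_reg 19 (2 * m))"
        unfolding m by (simp add: fps_X_power_mult_nth fps_nth_compose_X_power)
      moreover have "22 * i + 2 = 242 * m + 90" unfolding m by simp
      ultimately show ?thesis
        unfolding fps_nth_Abs_fps using cong_parity[OF b_reg_19_parity_step[of m]] by (simp only:)
    next
      case False
      have "\<not> (4 \<le> i \<and> 11 dvd i - 4)"
      proof
        assume "4 \<le> i \<and> 11 dvd i - 4"
        then obtain m where "4 \<le> i" "i - 4 = 11 * m" by (elim conjE dvdE)
        then have "i = 11 * m + 4" by simp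
        then show False using False by simp
      qed
      then have "fps_nth ?F i = int 0"
        by (auto simp: fps_X_power_mult_nth fps_nth_compose_X_power)
      then show ?thesis using cong_parity[of "b_reg 19 (22 * i + 2)" 0] even_b_reg_19[OF False] by simp
    qed
  qed
next
  fix k :: int and n :: nat
  assume k: "\<not> [k = 4] (mod 11) \<and> 0 \<le> 242 * int n + 22 * k + 2"
  define j where "j = nat (11 * int n + k)"
  \<comment> \<open>A negative k is allowed: 22 (11 n + k) \<ge> -2 excludes the integer 11 n + k
    from being negative.\<close>
  have "0 \<le> 11 * int n + k" using conjunct2[OF k] by linarith
  then have j: "int j = 11 * int n + k" by (simp add: j_def)
  then have N: "nat (242 * int n + 22 * k + 2) = 22 * j + 2" by linarith
  have "int (j mod 11) = k mod 11" using j by (simp add: zmod_int)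
  moreover have "k mod 11 \<noteq> 4" using conjunct1[OF k] by (simp add: cong_def)
  ultimately have "j mod 11 \<noteq> 4" by auto
  then show "[b_reg 19 (nat (242 * int n + 22 * k + 2)) = 0] (mod 2)"
    unfolding N using even_b_reg_19 by (simp add: cong_0_iff)
next
  fix d k n :: nat
  assume d: "1 \<le> d \<and> 1 \<le> k \<and> \<not> [k = 4] (mod 11)"
  then obtain e where e: "d = Suc e" by (cases d) auto
  define I where "I e = 2 * 11 ^ (2 * Suc e) * n + 2 * 11 ^ (2 * Suc e - 1) * k + 2 * 11 ^ (2 * Suc e - 2)
    + 90 * ((11 ^ (2 * Suc e - 2) - 1) div 120)" for e
  note I = index_recursion[where n = n and k = k, folded I_def]
  have "even (b_reg 19 (I e))"
  proof (induction e)
    case 0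
    \<comment> \<open>For d = 1 the index is 22 j + 2 with j = 11 n + k, which keeps the residue of
      k.\<close>
    have "(11 * n + k) mod 11 \<noteq> 4" using d by (simp add: cong_def)
    then show ?case unfolding I(2) by (rule even_b_reg_19)
  next
    case (Suc e)
    obtain m where m: "I e = 2 * m" using I(1)[of e] by (elim evenE)
    have "I (Suc e) = 242 * m + 90" unfolding I(3) m by simp
    then show ?case using Suc b_reg_19_parity_step[of m] m by simp
  qed
  then show "[b_reg 19 (2 * 11 ^ (2 * d) * n + 2 * 11 ^ (2 * d - 1) * k + 2 * 11 ^ (2 * d - 2)
      + 90 * ((11 ^ (2 * d - 2) - 1) div 120)) = 0] (mod 2)"
    unfolding e I_def by (simp only: cong_0_iff)
qed

end
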